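(* Let $n\ge1$ and $\alpha\in S_n$. The summation $FS_\alpha$ is an ordinary summation (that is, $d(FS_\alpha)=n+1$) if and only if $\alpha$ is a noncrossing permutation.
   Context: **The quiver $\hat Q_\alpha$.** For $\alpha\in S_n$, $\hat Q_\alpha$ is the directed graph with vertices $1,\dots,n+1$ and arrows $i\to\alpha(i)$ for $2\le i\le n$ together with $n+1\to\alpha(1)$. It consists of one chain, from $n+1$ to $1$, and possibly some loops (directed cycles, a vertex with a self-arrow being allowed). Each $t\in\{1,\dots,n\}$ is the target of exactly one arrow. One recovers $\alpha$ from $\hat Q_\alpha$ by replacing $n+1$ by $1$. For an arrow $a$, $s(a)$ is its source and $t(a)$ its target. **The permutations $[\alpha,j]\in S_{n+1}$.** For $\alpha\in S_n$ and $0\le j\le n$, $[\alpha,j]$ is the permutation $\beta\in S_{n+1}$ whose quiver $\hat Q_\beta$ (on vertices $1,\dots,n+2$) is obtained from $\hat Q_\alpha$ as follows. If $j=0$: add the vertex $n+2$ and the arrow $n+2\to n+1$. If $j\ge1$: let $i\to j$ be the unique arrow of $\hat Q_\alpha$ with target $j$; delete it, add the vertex $n+2$, and add the arrows $n+2\to j$ and $i\to n+1$. Every element of $S_{n+1}$ is $[\alpha,j]$ for exactly one pair $(\alpha,j)$. **The summations $FS_\alpha$.** Define recursively a set partition $\pi_\alpha$ of $\{1,\dots,n\}$ for $\alpha\in S_n$: for the unique element $(1)\in S_1$, $\pi_{(1)}=\{\{1\}\}$; $\pi_{[\alpha,0]}=\pi_\alpha\cup\{\{n+1\}\}$; for $1\le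 j\le n$, $\pi_{[\alpha,j]}$ is obtained from $\pi_\alpha$ by adding $n+1$ to the block containing $j$. For $k_1,\dots,k_n\ge1$ and $B\subseteq\{1,\dots,n\}$ put $k_B=\sum_{t\in B}k_t$. The summation $FS_\alpha$ of the $W$-operator $W([n])$ is the differential operator on $\mathbb{C}[p_1,p_2,\dots]$ $$FS_\alpha=\frac1n\sum_{k_1,\dots,k_n\ge1}\ \Big(\prod_{c}p_{k_c}\Big)\prod_{B\in\pi_\alpha}k_B\frac{\partial}{\partial p_{k_B}},$$ where $c$ runs over the (supports of the) disjoint cycles of $\alpha$, fixed points included. **Degree.** $dP(FS_\alpha)$ is the degree of the polynomial part (the number of factors $p_{k_c}$), $dD(FS_\alpha)$ is the order of the differential part (the number of factors $\partial/\partial p_{k_B}$), and $d(FS_\alpha)=dP(FS_\alpha)+dD(FS_\alpha)$. For $\alpha\in S_n$, $FS_\alpha$ is an ordinary summation (OS) if $d(FS_\alpha)=n+1$. **Noncrossing permutation.** Let $\alpha=\alpha_1\cdots\alpha_r$ be the decomposition of $\alpha\in S_n$ into disjoint cycles (fixed points included). $\alpha$ is a noncrossing permutation if: $( *_1)$ each arrow $a$ in the chain of $\hat Q_\alpha$ satisfies $t(a)<s(a)$, and in each loop of $\hat Q_\alpha$ there is at most one arrow $b$ with $s(b)<t(b)$; and $( *_2)$ any two distinct cycles $\alpha_i,\alpha_j$ satisfy at least one of: (a) for every element $m$ of $\alpha_i$, either $m>n'$ for all elements $n'$ of $\alpha_j$ or $m<n'$ for all elements $n'$ of $\alpha_j$;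 (b) for every element $m$ of $\alpha_j$, either $m>n'$ for all elements $n'$ of $\alpha_i$ or $m<n'$ for all elements $n'$ of $\alpha_i$. *)

theory Defs
  imports
    Complex_Main
    "HOL-Library.FuncSet"
    "HOL-Library.Multiset"
    "HOL-Library.Poly_Mapping"
    "HOL-Library.Disjoint_Sets"
    "HOL-Combinatorics.Permutations"
    "HOL-Combinatorics.Orbits"
begin

text \<open>
  An element of the symmetric group on n letters is a function \<open>\<alpha> :: nat \<Rightarrow> nat\<close> with
  \<open>\<alpha> permutes {1..n}\<close>. A quiver is the set of its arrows (source, target).
\<close>

section \<open>The quiver of a permutation\<close>

definition quiver :: "nat \<Rightarrow> (nat \<Rightarrow> nat) \<Rightarrow> (nat \<times> nat) set" where
  "quiver n \<alpha> = {(i, \<alpha> i) | i. 2 \<le> i \<and> i \<le> n} \<union> {(n + 1, \<alpha> 1)}"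

text \<open>The chain is the path that starts at the vertex \<open>n + 1\<close>.\<close>

definition chain_arrows :: "nat \<Rightarrow> (nat \<Rightarrow> nat) \<Rightarrow> (nat \<times> nat) set" where
  "chain_arrows n \<alpha> = {a \<in> quiver n \<alpha>. (n + 1, fst a) \<in> (quiver n \<alpha>)\<^sup>*}"

text \<open>
  A loop is given by its arrows. It passes through some vertex \<open>v\<close> that is reachable from itself
  by a nonempty path; every vertex has at most one outgoing arrow, so the loop consists of all
  arrows that can be reached from \<open>v\<close>.
\<close>

definition loops :: "nat \<Rightarrow> (nat \<Rightarrow> nat) \<Rightarrow> (nat \<times> nat) set set" where
  "loops n \<alpha> = {{a \<in> quiver n \<alpha>. (v, fst a) \<in> (quiver n \<alpha>)\<^sup>*} | v. (v, v) \<in> (quiver n \<alpha>)\<^sup>+}"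

section \<open>The permutations \<open>[\<alpha>, j]\<close>\<close>

definition extend_quiver :: "nat \<Rightarrow> (nat \<times> nat) set \<Rightarrow> nat \<Rightarrow> (nat \<times> nat) set" where
  "extend_quiver n Q j =
     (if j = 0 then insert (n + 2, n + 1) Q
      else let i = (THE i. (i, j) \<in> Q) in {(n + 2, j), (i, n + 1)} \<union> (Q - {(i, j)}))"

definition extend_perm :: "nat \<Rightarrow> (nat \<Rightarrow> nat) \<Rightarrow> nat \<Rightarrow> nat \<Rightarrow> nat" where
  "extend_perm n \<alpha> j =
     (THE \<beta>. \<beta> permutes {1..n + 1} \<and> quiver (n + 1) \<beta> = extend_quiver n (quiver n \<alpha>) j)"

lemma quiver_inject:
  assumes "\<alpha> permutes {1..n}" "\<beta> permutes {1..n}" "quiver n \<alpha> = quiver n \<beta>" "n \<ge> 1"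
  shows "\<alpha> = \<beta>"
proof
  fix x
  have 1: "\<alpha> 1 = \<beta> 1"
  proof -
    have "(n + 1, \<alpha> 1) \<in> quiver n \<beta>"
      unfolding assms(3)[symmetric] by (auto simp: quiver_def)
    then show ?thesis by (auto simp: quiver_def)
  qed
  have 2: "\<alpha> i = \<beta> i" if "2 \<le> i" "i \<le> n" for i
  proof -
    have "(i, \<alpha> i) \<in> quiver n \<beta>"
      unfolding assms(3)[symmetric] using that by (auto simp: quiver_def)
    with that show ?thesis by (auto simp: quiver_def)
  qed
  consider "x \<notin> {1..n}" | "x = 1" | "2 \<le> x" "x \<le> n" by fastforce
  then show "\<alpha> x = \<beta> x"
    using 1 2 assms(1,2) by cases (auto simp: permutes_not_in)
qed

lemma extend_perm_eq:
  assumes "\<alpha> permutes {1..n}" "n \<ge> 1" "j \<le> n"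
  shows "extend_perm n \<alpha> j =
    transpose (if j = 0 then n + 1 else j) (n + 1) \<circ> \<alpha> \<circ> transpose 1 (n + 1)"
    (is "_ = ?\<beta>")
    and "extend_perm n \<alpha> j permutes {1..n + 1}"
    and "quiver (n + 1) (extend_perm n \<alpha> j) = extend_quiver n (quiver n \<alpha>) j"
proof -
  have \<alpha>': "\<alpha> permutes {1..n + 1}"
    using assms(1) by (rule permutes_subset) auto
  have perm: "?\<beta> permutes {1..n + 1}"
    by (intro permutes_compose \<alpha>' permutes_swap_id) (use assms in auto)
  have fix_top: "\<alpha> (n + 1) = n + 1"
    using assms(1) by (auto simp: permutes_not_in)
  have range: "\<alpha> i \<in> {1..n}" if "i \<in> {1..n}" for i
    using assms(1) that by (simp only: permutes_in_image)
  have inj: "\<alpha> i = \<alpha> i' \<longleftrightarrow> i = i'" for i i'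
    using assms(1) by (metis permutes_inj inj_eq)
  define src where "src i = (if i = 1 then n + 1 else i)" for i
  have quiver_src: "quiver n \<alpha> = (\<lambda>i. (src i, \<alpha> i)) ` {1..n}"
  proof -
    have *: "{1..n} = insert 1 {2..n}" using assms(2) by auto
    show ?thesis unfolding * by (auto simp: quiver_def src_def)
  qed
  have quiv: "quiver (n + 1) ?\<beta> = extend_quiver n (quiver n \<alpha>) j"
  proof -
    have val: "?\<beta> (src i) = transpose (if j = 0 then n + 1 else j) (n + 1) (\<alpha> i)" if "i \<in> {1..n}" for i
      using that by (auto simp: src_def transpose_def)
    have val1: "?\<beta> 1 = (if j = 0 then n + 1 else j)"
      using fix_top by (auto simp: transpose_def)
    have lhs: "quiver (n + 1) ?\<beta> = insert (n + 2, ?\<beta> 1) ((\<lambda>i. (src i, ?\<beta> (src i))) ` {1..n})"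
    proof -
      have "{i. 2 \<le> i \<and> i \<le> n + 1} = src ` {1..n}"
      proof -
        have "i \<in> src ` {1..n}" if "2 \<le> i" "i \<le> n + 1" for i
          using that assms(2)
          by (intro image_eqI[of _ _ "if i = n + 1 then 1 else i"]) (auto simp: src_def)
        then show ?thesis by (auto simp: src_def split: if_splits)
      qed
      moreover have "quiver (n + 1) ?\<beta> =
          insert (n + 2, ?\<beta> 1) ((\<lambda>i. (i, ?\<beta> i)) ` {i. 2 \<le> i \<and> i \<le> n + 1})"
        unfolding quiver_def by auto
      ultimately show ?thesis by (simp only: image_image)
    qed
    also have "\<dots> = insert (n + 2, if j = 0 then n + 1 else j)
        ((\<lambda>i. (src i, transpose (if j = 0 then n + 1 else j) (n + 1) (\<alpha> i))) ` {1..n})"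
      unfolding val1 using val by (intro arg_cong2[of _ _ _ _ insert] image_cong) simp_all
    also have "\<dots> = extend_quiver n (quiver n \<alpha>) j"
    proof (cases "j = 0")
      case True
      then show ?thesis by (simp add: extend_quiver_def quiver_src)
    next
      case False
      define i where "i = inv \<alpha> j"
      have \<alpha>i: "\<alpha> i = j" unfolding i_def by (metis assms(1) permutes_inverses(1))
      have i: "i \<in> {1..n}"
        using False assms \<alpha>i by (metis atLeastAtMost_iff less_one not_less permutes_in_image)
      have "(THE s. (s, j) \<in> quiver n \<alpha>) = src i"
        unfolding quiver_src using \<alpha>i i inj by (intro the_equality) auto
      then have rhs: "extend_quiver n (quiver n \<alpha>) j =
          {(n + 2, j), (src i, n + 1)} \<union> ((\<lambda>x. (src x, \<alpha> x)) ` {1..n} - {(src i, j)})"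
        using False by (simp add: extend_quiver_def quiver_src Let_def)
      have tr: "transpose j (n + 1) (\<alpha> x) = (if x = i then n + 1 else \<alpha> x)" if "x \<in> {1..n}" for x
        using range[OF that] inj[of x i] \<alpha>i by (auto simp: transpose_def)
      have "(\<lambda>x. (src x, transpose j (n + 1) (\<alpha> x))) ` {1..n} =
          (\<lambda>x. (src x, transpose j (n + 1) (\<alpha> x))) ` insert i ({1..n} - {i})"
        using i by (simp only: insert_Diff)
      also have "\<dots> = insert (src i, n + 1)
          ((\<lambda>x. (src x, transpose j (n + 1) (\<alpha> x))) ` ({1..n} - {i}))"
        unfolding image_insert using tr[OF i] by simp
      also have "(\<lambda>x. (src x, transpose j (n + 1) (\<alpha> x))) ` ({1..n} - {i}) =
          (\<lambda>x. (src x, \<alpha> x)) ` ({1..n} - {i})"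
        by (intro image_cong refl) (use tr in auto)
      also have "\<dots> = (\<lambda>x. (src x, \<alpha> x)) ` {1..n} - {(src i, j)}"
        using \<alpha>i inj by auto
      finally have e: "(\<lambda>x. (src x, transpose j (n + 1) (\<alpha> x))) ` {1..n} =
          insert (src i, n + 1) ((\<lambda>x. (src x, \<alpha> x)) ` {1..n} - {(src i, j)})" .
      have jj: "(if j = 0 then n + 1 else j) = j" using False by simp
      show ?thesis unfolding rhs jj e by simp
    qed
    finally show ?thesis .
  qed
  show eq: "extend_perm n \<alpha> j = ?\<beta>"
    unfolding extend_perm_def
    by (rule the_equality) (use perm quiv in \<open>auto intro!: quiver_inject[where n = "n + 1"]\<close>)
  show "extend_perm n \<alpha> j permutes {1..n + 1}"
    unfolding eq by (rule perm)
  show "quiver (n + 1) (extend_perm n \<alpha> j) = extend_quiver n (quiver n \<alpha>) j"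
    unfolding eq by (rule quiv)
qed

lemma extend_perm_inject:
  assumes "\<alpha> permutes {1..n}" "j \<le> n" "\<alpha>' permutes {1..n}" "j' \<le> n" "n \<ge> 1"
    and eq: "extend_perm n \<alpha> j = extend_perm n \<alpha>' j'"
  shows "\<alpha> = \<alpha>' \<and> j = j'"
proof -
  have top: "\<alpha> (n + 1) = n + 1" "\<alpha>' (n + 1) = n + 1"
    using assms by (auto simp: permutes_not_in)
  have "extend_perm n \<alpha> j 1 = extend_perm n \<alpha>' j' 1" using eq by simp
  then have j: "j = j'"
    using assms(2,4) top
    by (auto simp: extend_perm_eq(1)[OF assms(1,5,2)] extend_perm_eq(1)[OF assms(3,5,4)]
        split: if_splits)
  define \<tau> where "\<tau> = transpose (if j = 0 then n + 1 else j) (n + 1)"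
  have "\<tau> \<circ> \<alpha> \<circ> transpose 1 (n + 1) = \<tau> \<circ> \<alpha>' \<circ> transpose 1 (n + 1)"
    using eq unfolding extend_perm_eq(1)[OF assms(1,5,2)] extend_perm_eq(1)[OF assms(3,5,4)]
    by (simp add: j \<tau>_def)
  then have "\<tau> \<circ> (\<tau> \<circ> \<alpha> \<circ> transpose 1 (n + 1)) \<circ> transpose 1 (n + 1) =
      \<tau> \<circ> (\<tau> \<circ> \<alpha>' \<circ> transpose 1 (n + 1)) \<circ> transpose 1 (n + 1)" by simp
  then have "\<alpha> = \<alpha>'" by (simp add: fun_eq_iff \<tau>_def)
  with j show ?thesis by simp
qed

lemma extend_perm_surj:
  assumes "\<beta> permutes {1..n + 1}" "n \<ge> 1"
  obtains \<alpha> j where "\<alpha> permutes {1..n}" "j \<le> n" "\<beta> = extend_perm n \<alpha> j"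
proof -
  define j where "j = (if \<beta> 1 = n + 1 then 0 else \<beta> 1)"
  have b1: "\<beta> 1 \<in> {1..n + 1}" using assms by (subst permutes_in_image) auto
  then have j: "j \<le> n" by (auto simp: j_def)
  have j': "(if j = 0 then n + 1 else j) = \<beta> 1" using b1 by (auto simp: j_def)
  define \<alpha> where "\<alpha> = transpose (\<beta> 1) (n + 1) \<circ> \<beta> \<circ> transpose 1 (n + 1)"
  have "\<alpha> permutes {1..n + 1}" unfolding \<alpha>_def
    by (intro permutes_compose assms permutes_swap_id) (use assms b1 in auto)
  then have \<alpha>: "\<alpha> permutes {1..n}"
  proof (rule permutes_superset)
    fix x assume "x \<in> {1..n + 1} - {1..n}"
    then have "x = n + 1" by auto
    then show "\<alpha> x = x" by (simp add: \<alpha>_def)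
  qed
  have "\<beta> = extend_perm n \<alpha> j"
    unfolding extend_perm_eq(1)[OF \<alpha> assms(2) j] j' by (simp add: \<alpha>_def fun_eq_iff)
  with \<alpha> j show ?thesis by (rule that)
qed

section \<open>The set partition \<open>\<pi>\<^sub>\<alpha>\<close>\<close>

text \<open>
  The recursion decomposes its argument in the unique way as \<open>[\<alpha>, j]\<close>; see the equations below.
  The case \<open>0\<close> is a dummy.
\<close>

fun set_partition :: "nat \<Rightarrow> (nat \<Rightarrow> nat) \<Rightarrow> nat set set" where
  "set_partition 0 \<beta> = {}"
| "set_partition (Suc 0) \<beta> = {{1}}"
| "set_partition (Suc (Suc m)) \<beta> =
     (let n = Suc m;
          (\<alpha>, j) = (THE (\<alpha>, j). \<alpha> permutes {1..n} \<and> j \<le> n \<and> \<beta> = extend_perm n \<alpha> j)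
      in if j = 0 then set_partition n \<alpha> \<union> {{n + 1}}
         else (\<lambda>B. if j \<in> B then insert (n + 1) B else B) ` set_partition n \<alpha>)"

lemma set_partition_extend:
  assumes "\<alpha> permutes {1..n}" "n \<ge> 1"
  shows "set_partition (n + 1) (extend_perm n \<alpha> 0) = set_partition n \<alpha> \<union> {{n + 1}}"
    and "1 \<le> j \<Longrightarrow> j \<le> n \<Longrightarrow> set_partition (n + 1) (extend_perm n \<alpha> j) =
           (\<lambda>B. if j \<in> B then insert (n + 1) B else B) ` set_partition n \<alpha>"
proof -
  obtain m where n: "n = Suc m" using assms(2) by (cases n) auto
  have the: "(THE (\<alpha>', i). \<alpha>' permutes {1..n} \<and> i \<le> n \<and>
      extend_perm n \<alpha> j = extend_perm n \<alpha>' i) = (\<alpha>, j)" if "j \<le> n" for j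
    by (rule the_equality) (use assms that extend_perm_inject[OF assms(1) that _ _ assms(2)] in auto)
  show "set_partition (n + 1) (extend_perm n \<alpha> 0) = set_partition n \<alpha> \<union> {{n + 1}}"
    using the[of 0] unfolding n by (simp add: Let_def)
  show "set_partition (n + 1) (extend_perm n \<alpha> j) =
      (\<lambda>B. if j \<in> B then insert (n + 1) B else B) ` set_partition n \<alpha>" if "1 \<le> j" "j \<le> n"
    using the[of j] that unfolding n by (simp add: Let_def)
qed

lemma partition_on_set_partition:
  assumes "\<alpha> permutes {1..n}"
  shows "partition_on {1..n} (set_partition n \<alpha>)"
  using assms
proof (induction n arbitrary: \<alpha>)
  case 0
  then show ?case by (simp add: partition_on_def)
next
  case (Suc n)
  show ?case
  proof (cases "n = 0")
    case True
    then show ?thesis by (auto simp: partition_on_def)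
  next
    case False
    then have n: "n \<ge> 1" by simp
    obtain \<alpha>' j where \<alpha>': "\<alpha>' permutes {1..n}" "j \<le> n" "\<alpha> = extend_perm n \<alpha>' j"
      using extend_perm_surj[of \<alpha> n] Suc.prems n by auto
    let ?P = "set_partition n \<alpha>'"
    have P: "partition_on {1..n} ?P" using Suc.IH \<alpha>'(1) .
    have un: "\<Union>?P = {1..n}" using P by (simp add: partition_on_def)
    have fresh: "n + 1 \<notin> B" if "B \<in> ?P" for B using Union_upper[OF that] unfolding un by auto
    show ?thesis
    proof (cases "j = 0")
      case True
      have "partition_on ({1..n} \<union> {n + 1}) (?P \<union> {{n + 1}})"
      proof -
        have "{1..n} \<union> {n + 1} - {n + 1} = {1..n}" by auto
        moreover have "disjnt {n + 1} (\<Union>?P)" unfolding un by (simp add: disjnt_def)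
        ultimately show ?thesis using P by (simp add: partition_on_insert)
      qed
      moreover have "{1..n} \<union> {n + 1} = {1..Suc n}" by auto
      ultimately show ?thesis
        using set_partition_extend(1)[OF \<alpha>'(1) n] \<alpha>'(3) True by simp
    next
      case False
      let ?f = "\<lambda>B. if j \<in> B then insert (n + 1) B else B"
      have eq: "set_partition (Suc n) \<alpha> = ?f ` ?P"
        unfolding \<alpha>'(3) Suc_eq_plus1
        by (rule set_partition_extend(2)[OF \<alpha>'(1) n]) (use \<alpha>'(2) False in auto)
      have "j \<in> \<Union>?P" unfolding un using \<alpha>'(2) False by simp
      then obtain B\<^sub>0 where B\<^sub>0: "B\<^sub>0 \<in> ?P" "j \<in> B\<^sub>0" by blast
      have "\<Union>(?f ` ?P) = insert (n + 1) (\<Union>?P)"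
      proof (intro equalityI subsetI)
        fix x assume "x \<in> insert (n + 1) (\<Union>?P)"
        then consider "x = n + 1" | B where "B \<in> ?P" "x \<in> B" by blast
        then show "x \<in> \<Union>(?f ` ?P)"
        proof cases
          case 1
          then have "x \<in> ?f B\<^sub>0" using B\<^sub>0 by simp
          then show ?thesis using B\<^sub>0(1) by (rule UN_I[rotated])
        next
          case 2
          then have "x \<in> ?f B" by simp
          then show ?thesis using 2(1) by (rule UN_I[rotated])
        qed
      next
        fix x assume "x \<in> \<Union>(?f ` ?P)"
        then obtain B where "B \<in> ?P" "x \<in> ?f B" by (rule UN_E)
        then show "x \<in> insert (n + 1) (\<Union>?P)" by (cases "j \<in> B") auto
      qed
      also have "\<dots> = {1..Suc n}" unfolding un by auto
      finally have "\<Union>(?f ` ?P) = {1..Suc n}" .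
      moreover have "disjoint (?f ` ?P)"
      proof (rule disjointI)
        fix a b assume a: "a \<in> ?f ` ?P" and b: "b \<in> ?f ` ?P" and ab: "a \<noteq> b"
        obtain A where A: "a = ?f A" "A \<in> ?P" using a by (rule imageE)
        obtain B where B: "b = ?f B" "B \<in> ?P" using b by (rule imageE)
        have "A \<noteq> B" using ab A(1) B(1) by blast
        with A(2) B(2) have "A \<inter> B = {}" by (intro disjointD[OF partition_onD2[OF P]])
        then show "a \<inter> b = {}"
          unfolding A(1) B(1) using fresh[OF A(2)] fresh[OF B(2)] by auto
      qed
      moreover have "{} \<notin> ?f ` ?P" using P by (auto simp: partition_on_def)
      ultimately show ?thesis unfolding eq partition_on_def by (intro conjI)
    qed
  qed
qed

section \<open>Differential operators on polynomials in \<open>p\<^sub>1, p\<^sub>2, \<dots>\<close>\<close>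

text \<open>
  A monomial is its exponent vector. The type also has a variable with index 0; the operators below
  neither multiply by it nor differentiate with respect to it.
\<close>

type_synonym ppoly = "(nat \<Rightarrow>\<^sub>0 nat) \<Rightarrow>\<^sub>0 complex"

definition pvar :: "nat \<Rightarrow> ppoly" where
  "pvar k = Poly_Mapping.single (Poly_Mapping.single k 1) 1"

definition pdiff :: "nat \<Rightarrow> ppoly \<Rightarrow> ppoly" where
  "pdiff k f = (\<Sum>m\<in>Poly_Mapping.keys f. Poly_Mapping.single (m - Poly_Mapping.single k 1)
     (Poly_Mapping.lookup f m * of_nat (Poly_Mapping.lookup m k)))"

lemma lookup_pdiff:
  "Poly_Mapping.lookup (pdiff k f) m =
     Poly_Mapping.lookup f (m + Poly_Mapping.single k 1) * of_nat (Poly_Mapping.lookup m k + 1)"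
proof -
  let ?m = "m + Poly_Mapping.single k 1"
  have shift: "m' = ?m" if "m' - Poly_Mapping.single k 1 = m" "Poly_Mapping.lookup m' k \<noteq> 0" for m'
  proof (rule poly_mapping_eqI)
    fix i
    show "Poly_Mapping.lookup m' i = Poly_Mapping.lookup ?m i"
      using that by (auto simp: lookup_add lookup_minus lookup_single when_def)
  qed
  have "Poly_Mapping.lookup (pdiff k f) m = (\<Sum>m'\<in>Poly_Mapping.keys f.
      if m' = ?m then Poly_Mapping.lookup f m' * of_nat (Poly_Mapping.lookup m' k) else 0)"
    unfolding pdiff_def lookup_sum
    by (intro sum.cong) (use shift in \<open>auto simp: lookup_single when_def\<close>)
  also have "\<dots> = Poly_Mapping.lookup f ?m * of_nat (Poly_Mapping.lookup ?m k)"
    by (auto simp: sum.delta in_keys_iff)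
  finally show ?thesis by (simp add: lookup_add)
qed

lemma pdiff_comp_fun_commute: "comp_fun_commute pdiff"
proof
  fix k l
  show "pdiff l \<circ> pdiff k = pdiff k \<circ> pdiff l"
  proof
    fix f
    have "Poly_Mapping.lookup (pdiff l (pdiff k f)) m = Poly_Mapping.lookup (pdiff k (pdiff l f)) m"
      for m
      by (cases "k = l") (auto simp: lookup_pdiff lookup_add lookup_single when_def ac_simps)
    then show "(pdiff l \<circ> pdiff k) f = (pdiff k \<circ> pdiff l) f"
      by (simp add: poly_mapping_eqI)
  qed
qed

text \<open>
  A term \<open>c \<cdot> \<Prod>p\<^sub>i \<cdot> \<Prod>\<partial>/\<partial>p\<^sub>j\<close> consists of its coefficient, the indices of the factors of its polynomial
  part and the indices of the factors of its differential part, the latter two with multiplicity.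
\<close>

datatype diff_term =
  Diff_Term (coefficient: complex) (poly_part: "nat multiset") (diff_part: "nat multiset")

definition apply_term :: "diff_term \<Rightarrow> ppoly \<Rightarrow> ppoly" where
  "apply_term T f = Poly_Mapping.single 0 (coefficient T) * (\<Prod>i\<in>#poly_part T. pvar i) *
     fold_mset pdiff f (diff_part T)"

text \<open>
  A summation is an infinite formal sum of such terms, indexed by tuples \<open>k\<close> of positive integers.
  It acts as a differential operator if only finitely many terms act nontrivially on each polynomial.
\<close>

datatype summation =
  Summation (index_set: "(nat \<Rightarrow> nat) set") (summand: "(nat \<Rightarrow> nat) \<Rightarrow> diff_term")

definition apply_summation :: "summation \<Rightarrow> ppoly \<Rightarrow> ppoly" where
  "apply_summation S f =
     (\<Sum>k | k \<in> index_set S \<and> apply_term (summand S k) f \<noteq> 0. apply_term (summand S k) f)"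

definition dP :: "summation \<Rightarrow> nat" where
  "dP S = Max ((\<lambda>k. size (poly_part (summand S k))) ` index_set S)"

definition dD :: "summation \<Rightarrow> nat" where
  "dD S = Max ((\<lambda>k. size (diff_part (summand S k))) ` index_set S)"

definition summation_degree :: "summation \<Rightarrow> nat" where
  "summation_degree S = dP S + dD S"

section \<open>The summations \<open>FS\<^sub>\<alpha>\<close>\<close>

text \<open>A cycle is represented by its support; fixed points give singletons.\<close>

definition cycles :: "nat \<Rightarrow> (nat \<Rightarrow> nat) \<Rightarrow> nat set set" where
  "cycles n \<alpha> = orbit \<alpha> ` {1..n}"

definition FS_term :: "nat \<Rightarrow> (nat \<Rightarrow> nat) \<Rightarrow> (nat \<Rightarrow> nat) \<Rightarrow> diff_term" where
  "FS_term n \<alpha> k = Diff_Term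
     (1 / of_nat n * (\<Prod>B\<in>set_partition n \<alpha>. of_nat (\<Sum>t\<in>B. k t)))
     (image_mset (\<lambda>c. \<Sum>t\<in>c. k t) (mset_set (cycles n \<alpha>)))
     (image_mset (\<lambda>B. \<Sum>t\<in>B. k t) (mset_set (set_partition n \<alpha>)))"

definition FS :: "nat \<Rightarrow> (nat \<Rightarrow> nat) \<Rightarrow> summation" where
  "FS n \<alpha> = Summation ({1..n} \<rightarrow>\<^sub>E {1..}) (FS_term n \<alpha>)"

text \<open>All terms of \<open>FS\<^sub>\<alpha>\<close> have the same numbers of factors, so the maxima above are these numbers.\<close>

lemma dP_FS: "dP (FS n \<alpha>) = card (cycles n \<alpha>)"
  and dD_FS: "dD (FS n \<alpha>) = card (set_partition n \<alpha>)"
proof -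
  have ne: "{1..n} \<rightarrow>\<^sub>E {1 :: nat..} \<noteq> {}"
    by (simp add: PiE_eq_empty_iff)
  show "dP (FS n \<alpha>) = card (cycles n \<alpha>)" "dD (FS n \<alpha>) = card (set_partition n \<alpha>)"
    using ne by (simp_all add: dP_def dD_def FS_def FS_term_def image_constant_conv)
qed

lemma finite_FS_nonzero:
  assumes "\<alpha> permutes {1..n}"
  shows "finite {k \<in> index_set (FS n \<alpha>). apply_term (summand (FS n \<alpha>) k) f \<noteq> 0}"
proof -
  let ?V = "\<Union>m\<in>Poly_Mapping.keys f. Poly_Mapping.keys m"
  obtain N where N: "\<And>v. v \<in> ?V \<Longrightarrow> v \<le> N"
    by (meson finite_UN finite_keys finite_nat_set_iff_bounded_le)
  have pd0: "pdiff v f = 0" if "v > N" for v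
  proof -
    have "Poly_Mapping.lookup m v = 0" if "m \<in> Poly_Mapping.keys f" for m
      using N[of v] \<open>v > N\<close> that by (force simp: in_keys_iff)
    then show ?thesis by (simp add: pdiff_def)
  qed
  interpret comp_fun_commute pdiff by (rule pdiff_comp_fun_commute)
  have fold0: "fold_mset pdiff 0 M = 0" for M
  proof (induction M)
    case (add x M)
    have "pdiff x 0 = 0" by (simp add: pdiff_def)
    with add show ?case by (simp add: fold_mset_fun_left_comm)
  qed simp
  have part: "partition_on {1..n} (set_partition n \<alpha>)"
    using assms by (rule partition_on_set_partition)
  have bound: "k t \<le> N"
    if k: "k \<in> index_set (FS n \<alpha>)" "apply_term (summand (FS n \<alpha>) k) f \<noteq> 0" and t: "t \<in> {1..n}"
    for k t
  proof (rule ccontr)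
    assume "\<not> k t \<le> N"
    obtain B where B: "B \<in> set_partition n \<alpha>" "t \<in> B"
      using t unfolding partition_onD1[OF part] by (rule UnionE)
    have "finite (set_partition n \<alpha>)" "finite B"
      using finite_elements[OF _ part] finite_subset[of B "{1..n}"] partition_onD1[OF part] B(1)
      by auto
    moreover have "k t \<le> sum k B" using \<open>finite B\<close> B(2) by (intro member_le_sum) auto
    moreover have "sum k B \<in># diff_part (FS_term n \<alpha> k)"
      using \<open>finite (set_partition n \<alpha>)\<close> B(1) by (auto simp: FS_term_def)
    ultimately obtain M where "diff_part (FS_term n \<alpha> k) = add_mset (sum k B) M"
      by (meson multi_member_split)
    then have "fold_mset pdiff f (diff_part (FS_term n \<alpha> k)) = fold_mset pdiff (pdiff (sum k B) f) M"
      by (simp add: fold_mset_fun_left_comm)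
    also have "\<dots> = 0"
      using pd0[of "sum k B"] \<open>\<not> k t \<le> N\<close> \<open>k t \<le> sum k B\<close> by (simp add: fold0)
    finally show False using k(2) by (simp add: apply_term_def FS_def)
  qed
  have "{k \<in> index_set (FS n \<alpha>). apply_term (summand (FS n \<alpha>) k) f \<noteq> 0} \<subseteq> {1..n} \<rightarrow>\<^sub>E {..N}"
  proof
    fix k assume k: "k \<in> {k \<in> index_set (FS n \<alpha>). apply_term (summand (FS n \<alpha>) k) f \<noteq> 0}"
    then have "k \<in> {1..n} \<rightarrow>\<^sub>E {1..}" by (simp add: FS_def)
    moreover have "k t \<le> N" if "t \<in> {1..n}" for t using bound[OF _ _ that] k by blast
    ultimately show "k \<in> {1..n} \<rightarrow>\<^sub>E {..N}" unfolding PiE_iff by blast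
  qed
  then show ?thesis by (rule finite_subset) (simp add: finite_PiE)
qed

definition ordinary_summation :: "nat \<Rightarrow> (nat \<Rightarrow> nat) \<Rightarrow> bool" where
  "ordinary_summation n \<alpha> \<longleftrightarrow> summation_degree (FS n \<alpha>) = n + 1"

section \<open>Noncrossing permutations\<close>

definition separated :: "nat set \<Rightarrow> nat set \<Rightarrow> bool" where
  "separated A B \<longleftrightarrow> (\<forall>m\<in>A. (\<forall>x\<in>B. m > x) \<or> (\<forall>x\<in>B. m < x))"

definition noncrossing_perm :: "nat \<Rightarrow> (nat \<Rightarrow> nat) \<Rightarrow> bool" where
  "noncrossing_perm n \<alpha> \<longleftrightarrow>
     (\<forall>(s, t)\<in>chain_arrows n \<alpha>. t < s) \<and>
     (\<forall>L\<in>loops n \<alpha>. card {(s, t)\<in>L. s < t} \<le> 1) \<and>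
     (\<forall>A\<in>cycles n \<alpha>. \<forall>B\<in>cycles n \<alpha>. A \<noteq> B \<longrightarrow> separated A B \<or> separated B A)"

end

theory Submission
  imports Defs
begin

text \<open>
  The degree of \<open>FS\<^sub>\<alpha>\<close> is the number of cycles of \<open>\<alpha>\<close> plus the number of blocks of \<open>\<pi>\<^sub>\<alpha>\<close>. Both
  numbers are followed along the recursion \<open>\<beta> = [\<alpha>, j]\<close>, which in terms of permutations reads
  \<open>\<beta> = (j N) \<circ> \<alpha> \<circ> (1 N)\<close> with \<open>N = n + 1\<close>, the left factor being absent for \<open>j = 0\<close>. The factor
  \<open>(1 N)\<close> only inserts \<open>N\<close> into the cycle of 1, giving \<open>\<gamma> = [\<alpha>, 0]\<close> with as many cycles as \<open>\<alpha>\<close>.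
  Multiplying \<open>\<gamma>\<close> by \<open>(j N)\<close> splits the cycle of 1, which contains \<open>N\<close>, if \<open>j\<close> lies on it, and merges
  it with the cycle of \<open>j\<close> otherwise. So the step adds one block if \<open>j = 0\<close>, adds one cycle if
  \<open>j\<close> is on the chain, and removes one cycle in the remaining case. The degree starts at 2 for
  \<open>n = 1\<close> and increases by at most one per step; hence it equals \<open>n + 1\<close> iff every step of the
  recursion has \<open>j = 0\<close> or \<open>j\<close> on the chain.

  Noncrossing permutations satisfy the same recursion. It is convenient to forget the quiver: the
  conditions on chain and loops together say that \<open>\<alpha> x < x\<close> for every \<open>x\<close> that is not the smallest
  element of its cycle, and pairwise separation of cycles says that no \<open>a < b < c < d\<close> have \<open>a, c\<close>
  in one cycle and \<open>b, d\<close> in another (\<open>noncrossing_perm_iff\<close>). Inserting the largest letter \<open>N\<close>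
  directly after 1 affects neither condition. If \<open>j\<close> is on the chain, then the chain is cut between
  its elements up to \<open>j\<close> and those above \<open>j\<close>; since the chain descends, both pieces are again
  descending cycles and one lies entirely below the other, so they cross nothing new. Conversely, two
  such cycles can be glued back together. If \<open>j\<close> is on a loop, the merged cycle contains an arrow that
  rises to \<open>N\<close> away from its smallest element 1, so \<open>\<beta>\<close> is not noncrossing.
\<close>

section \<open>Orbits under multiplication by a transposition\<close>

lemma orbit_subset_closed:
  assumes "x \<in> A" "\<And>y. y \<in> A \<Longrightarrow> f y \<in> A"
  shows "orbit f x \<subseteq> A"
proof
  fix y assume "y \<in> orbit f x"
  then show "y \<in> A" by induction (use assms in auto)
qed

lemma orbit_eq_iff:
  assumes "permutation p"
  shows "orbit p x = orbit p y \<longleftrightarrow> y \<in> orbit p x"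
proof
  assume "orbit p x = orbit p y"
  then show "y \<in> orbit p x" using permutation_self_in_orbit[OF assms, of y] by simp
next
  assume "y \<in> orbit p x"
  then show "orbit p x = orbit p y"
    using orbit_cyclic_eq3[OF cyclic_on_orbit'[OF assms]] by metis
qed

lemma orbit_step_iff:
  assumes "permutation p"
  shows "p y \<in> orbit p x \<longleftrightarrow> y \<in> orbit p x"
  using orbit_eq_iff[OF assms, of x] permutation_orbit_step[OF assms, of y] by metis

lemma orbit_disjoint_closed:
  assumes "permutation p" "\<And>y. y \<in> A \<Longrightarrow> p y \<in> A" "x \<notin> A"
  shows "orbit p x \<inter> A = {}"
proof (rule ccontr)
  assume "orbit p x \<inter> A \<noteq> {}"
  then obtain y where y: "y \<in> orbit p x" "y \<in> A" by blast
  have "x \<in> orbit p y"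
    using y(1) orbit_eq_iff[OF assms(1)] by metis
  also have "orbit p y \<subseteq> A" using y(2) assms(2) by (rule orbit_subset_closed)
  finally show False using assms(3) by simp
qed

text \<open>
  If the orbit \<open>a, p a, p (p a), \<dots>\<close> first reaches \<open>b\<close> after \<open>k\<close> steps, then the element before \<open>b\<close>
  is now sent back to \<open>a\<close>. So the new orbit of \<open>a\<close> closes up just before it would reach \<open>b\<close>.
\<close>

lemma orbit_transpose_split:
  assumes "b \<in> orbit p a" "a \<noteq> b"
  shows "b \<notin> orbit (transpose a b \<circ> p) a"
proof -
  define k where "k = funpow_dist1 p a b"
  define A where "A = (\<lambda>i. (p ^^ i) a) ` {..<k}"
  have hit: "(p ^^ k) a = b"
    unfolding k_def by (rule funpow_dist1_prop[OF assms(1)])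
  have miss: "(p ^^ i) a \<noteq> b" if "i < k" for i
    using funpow_dist1_least[of i p a b] that assms(2) by (cases "i = 0") (auto simp: k_def)
  have no_return: "(p ^^ i) a \<noteq> a" if "0 < i" "i < k" for i
    using funpow_neq_less_funpow_dist1[OF assms(1), of i 0] that by (simp add: k_def)
  have a: "a \<in> A"
    unfolding A_def by (rule image_eqI[of _ _ 0]) (auto simp: k_def)
  have "orbit (transpose a b \<circ> p) a \<subseteq> A"
  proof (rule orbit_subset_closed[OF a])
    fix y assume "y \<in> A"
    then obtain i where i: "i < k" "y = (p ^^ i) a" unfolding A_def by blast
    show "(transpose a b \<circ> p) y \<in> A"
    proof (cases "Suc i = k")
      case True
      then show ?thesis using hit a i by auto
    next
      case False
      then have "Suc i < k" using i(1) by simp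
      then have "(transpose a b \<circ> p) y = (p ^^ Suc i) a"
        using miss[of "Suc i"] no_return[of "Suc i"] i(2) by simp
      then show ?thesis
        using \<open>Suc i < k\<close> unfolding A_def by blast
    qed
  qed
  moreover have "b \<notin> A" using miss unfolding A_def by blast
  ultimately show ?thesis by blast
qed

text \<open>
  Following the new permutation from \<open>a\<close>, one runs through the old cycle of \<open>a\<close> until it would return
  to \<open>a\<close> and is then redirected to \<open>b\<close>, and in the same way from \<open>b\<close> back to \<open>a\<close>. Splitting is the
  inverse operation, because the transposition is an involution; this lemma therefore also describes
  the orbits after a split, once \<open>orbit_transpose_split\<close> has shown that \<open>a\<close> and \<open>b\<close> are separated.
\<close>

lemma orbit_transpose_merge:
  assumes p: "permutation p" and b: "b \<notin> orbit p a"
  shows "orbit (transpose a b \<circ> p) x =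
    (if x \<in> orbit p a \<union> orbit p b then orbit p a \<union> orbit p b else orbit p x)"
proof -
  define q where "q = transpose a b \<circ> p"
  let ?A = "orbit p a" and ?B = "orbit p b"
  have q: "permutation q"
    unfolding q_def by (intro permutation_compose p permutation_swap_id)
  note self = permutation_self_in_orbit[OF p] permutation_self_in_orbit[OF q]
  have inside: "q y \<in> ?A \<union> ?B" if "y \<in> ?A \<union> ?B" for y
    using that self(1) by (auto simp: q_def transpose_def intro: orbit.step)
  have "b \<in> orbit q a"
  proof (rule ccontr)
    assume nb: "b \<notin> orbit q a"
    \<comment> \<open>The finite set \<open>Y\<close> would be mapped injectively into \<open>Y - {a}\<close>.\<close>
    define Y where "Y = orbit q a \<inter> ?A"
    have "q y \<in> Y - {a}" if "y \<in> Y" for y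
    proof -
      have 1: "q y \<in> orbit q a" "p y \<in> ?A"
        using that by (auto simp: Y_def intro: orbit.step)
      then have "p y \<noteq> b" using b by auto
      moreover have "p y \<noteq> a" using 1(1) nb by (auto simp: q_def)
      ultimately show ?thesis using 1 by (simp add: Y_def q_def)
    qed
    then have "q ` Y \<subseteq> Y - {a}" by blast
    moreover have fin: "finite Y"
      unfolding Y_def using finite_orbit[OF self(1)] by blast
    ultimately have "card (q ` Y) \<le> card (Y - {a})" by (intro card_mono) auto
    moreover have "card (q ` Y) = card Y"
      using bij_is_inj[OF permutation_bijective[OF q]] by (intro card_image) (auto simp: inj_on_def)
    moreover have "a \<in> Y" using self by (simp add: Y_def)
    then have "card (Y - {a}) < card Y"
      using fin by (rule card_Diff1_less[rotated])
    ultimately show False by simp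
  qed
  have p_closed: "p y \<in> orbit q a" if "y \<in> orbit q a" for y
  proof -
    have "q y \<in> orbit q a" using that by (rule orbit.step)
    then show ?thesis
      using self(2)[of a] \<open>b \<in> orbit q a\<close> by (auto simp: q_def transpose_def split: if_splits)
  qed
  have merged: "orbit q a = ?A \<union> ?B"
  proof
    show "orbit q a \<subseteq> ?A \<union> ?B"
      by (rule orbit_subset_closed) (use inside self(1) in auto)
    show "?A \<union> ?B \<subseteq> orbit q a"
      using orbit_subset_closed[of a "orbit q a" p] orbit_subset_closed[of b "orbit q a" p]
        self(2)[of a] \<open>b \<in> orbit q a\<close> p_closed by blast
  qed
  have "orbit q x = (if x \<in> ?A \<union> ?B then ?A \<union> ?B else orbit p x)"
  proof (cases "x \<in> ?A \<union> ?B")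
    case True
    then have "orbit q a = orbit q x" using merged orbit_eq_iff[OF q] by blast
    then show ?thesis using True merged by simp
  next
    case False
    have "orbit q x = orbit p x"
    proof (rule orbit_cong)
      show "x \<in> orbit p x" by (rule self(1))
      fix s assume "s \<in> orbit p x"
      then have "p s \<in> orbit p x" by (rule orbit.step)
      then have "p s \<noteq> a" "p s \<noteq> b"
        using False orbit_eq_iff[OF p] by (metis Un_iff)+
      then show "q s = p s" by (simp add: q_def)
    qed
    then show ?thesis using False by simp
  qed
  then show ?thesis by (simp add: q_def)
qed

lemma card_orbits_transpose_merge:
  assumes p: "p permutes S" and fin: "finite S" and S: "a \<in> S" "b \<in> S" and b: "b \<notin> orbit p a"
  shows "card (orbit (transpose a b \<circ> p) ` S) + 1 = card (orbit p ` S)"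
proof -
  have perm: "permutation p" using p fin by (auto simp: permutation_permutes)
  note eq = orbit_eq_iff[OF perm] and self = permutation_self_in_orbit[OF perm]
  let ?A = "orbit p a" and ?B = "orbit p b"
  have ne: "?A \<noteq> ?B" using b eq by blast
  have "orbit (transpose a b \<circ> p) ` S = insert (?A \<union> ?B) (orbit p ` S - {?A, ?B})" (is "?L = ?R")
  proof
    show "?L \<subseteq> ?R" using orbit_transpose_merge[OF perm b] self by auto
    show "?R \<subseteq> ?L"
    proof
      fix X assume "X \<in> ?R"
      then consider "X = ?A \<union> ?B" | x where "x \<in> S" "X = orbit p x" "X \<noteq> ?A" "X \<noteq> ?B" by blast
      then show "X \<in> ?L"
      proof cases
        case 1
        then have "X = orbit (transpose a b \<circ> p) a"
          using orbit_transpose_merge[OF perm b] self by simp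
        then show ?thesis using S by blast
      next
        case 2
        then have "x \<notin> ?A \<union> ?B" using eq by blast
        then have "X = orbit (transpose a b \<circ> p) x"
          using orbit_transpose_merge[OF perm b] 2 by simp
        then show ?thesis using 2 by blast
      qed
    qed
  qed
  moreover have "?A \<union> ?B \<notin> orbit p ` S - {?A, ?B}"
  proof
    assume "?A \<union> ?B \<in> orbit p ` S - {?A, ?B}"
    then obtain x where "orbit p x = ?A \<union> ?B" "orbit p x \<noteq> ?A" by blast
    then show False using self[of a] eq by blast
  qed
  moreover have "card (orbit p ` S - {?A, ?B}) + 2 = card (orbit p ` S)"
  proof -
    have "{?A, ?B} \<subseteq> orbit p ` S" using S by blast
    then have "card (orbit p ` S - {?A, ?B}) = card (orbit p ` S) - card {?A, ?B}"
        "card {?A, ?B} \<le> card (orbit p ` S)"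
      using fin by (auto intro!: card_Diff_subset card_mono)
    then show ?thesis using ne by simp
  qed
  ultimately show ?thesis using fin by simp
qed

section \<open>Noncrossing permutations in terms of orbits\<close>

definition descending_cycles :: "nat \<Rightarrow> (nat \<Rightarrow> nat) \<Rightarrow> bool" where
  "descending_cycles n \<alpha> \<longleftrightarrow>
     (\<forall>x\<in>{1..n}. \<forall>y\<in>orbit \<alpha> x. y < x \<longrightarrow> \<alpha> x < x)"

definition noncrossing_orbits :: "nat \<Rightarrow> (nat \<Rightarrow> nat) \<Rightarrow> bool" where
  "noncrossing_orbits n \<alpha> \<longleftrightarrow>
     (\<forall>a b c d. 1 \<le> a \<and> a < b \<and> b < c \<and> c < d \<and> d \<le> n \<and>
        orbit \<alpha> a = orbit \<alpha> c \<and> orbit \<alpha> b = orbit \<alpha> d \<longrightarrow> orbit \<alpha> a = orbit \<alpha> b)"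

lemma descending_cyclesD:
  "descending_cycles n \<alpha> \<Longrightarrow> 1 \<le> x \<Longrightarrow> x \<le> n \<Longrightarrow> y \<in> orbit \<alpha> x \<Longrightarrow> y < x \<Longrightarrow> \<alpha> x < x"
  unfolding descending_cycles_def by auto

lemma noncrossing_orbitsD:
  "noncrossing_orbits n \<alpha> \<Longrightarrow> 1 \<le> a \<Longrightarrow> a < b \<Longrightarrow> b < c \<Longrightarrow> c < d \<Longrightarrow> d \<le> n \<Longrightarrow>
    orbit \<alpha> a = orbit \<alpha> c \<Longrightarrow> orbit \<alpha> b = orbit \<alpha> d \<Longrightarrow> orbit \<alpha> a = orbit \<alpha> b"
  unfolding noncrossing_orbits_def by blast

text \<open>
  If neither set separates the other, there is an element \<open>m\<close> of \<open>A\<close> between two elements of \<open>B\<close> and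
  an element \<open>m'\<close> of \<open>B\<close> between two elements of \<open>A\<close>. Whichever of \<open>m\<close> and \<open>m'\<close> is smaller, the two
  together with one outer element on each side alternate between the sets.
\<close>

lemma separated_iff_no_alternation:
  assumes "A \<inter> B = {}"
  shows "separated A B \<or> separated B A \<longleftrightarrow>
    \<not> (\<exists>a\<in>A. \<exists>b\<in>B. \<exists>a'\<in>A. \<exists>b'\<in>B. a < b \<and> b < a' \<and> a' < b' \<or> b < a \<and> a < b' \<and> b' < a')"
    (is "?S \<longleftrightarrow> \<not> ?C")
proof
  assume ?S
  then show "\<not> ?C" unfolding separated_def by (meson not_less_iff_gr_or_eq)
next
  assume C: "\<not> ?C"
  show ?S
  proof (rule ccontr)
    assume "\<not> ?S"
    then obtain m x y m' x' y' where
      1: "m \<in> A" "x \<in> B" "y \<in> B" "\<not> m > x" "\<not> m < y" and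
      2: "m' \<in> B" "x' \<in> A" "y' \<in> A" "\<not> m' > x'" "\<not> m' < y'"
      unfolding separated_def by meson
    have ne: "m \<noteq> x" "m \<noteq> y" "m' \<noteq> x'" "m' \<noteq> y'" "m \<noteq> m'" using 1 2 assms by auto
    have "y < m" "m < x" "y' < m'" "m' < x'"
      using 1(4,5) 2(4,5) ne by linarith+
    then show False using C 1 2 ne(5) by (meson linorder_less_linear)
  qed
qed

lemma separated_cycles_iff:
  assumes "\<alpha> permutes {1..n}"
  shows "(\<forall>A\<in>cycles n \<alpha>. \<forall>B\<in>cycles n \<alpha>. A \<noteq> B \<longrightarrow> separated A B \<or> separated B A) \<longleftrightarrow>
    noncrossing_orbits n \<alpha>" (is "?L \<longleftrightarrow> _")
proof
  have perm: "permutation \<alpha>" using assms by (auto simp: permutation_permutes)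
  note eq = orbit_eq_iff[OF perm] and self = permutation_self_in_orbit[OF perm]
  have disj: "orbit \<alpha> x \<inter> orbit \<alpha> y = {}" if "orbit \<alpha> x \<noteq> orbit \<alpha> y" for x y
    using that eq by blast
  {
    assume L: ?L
    show "noncrossing_orbits n \<alpha>"
      unfolding noncrossing_orbits_def
    proof (intro allI impI, rule ccontr)
      fix a b c d
      assume h: "1 \<le> a \<and> a < b \<and> b < c \<and> c < d \<and> d \<le> n \<and>
        orbit \<alpha> a = orbit \<alpha> c \<and> orbit \<alpha> b = orbit \<alpha> d" and ne: "orbit \<alpha> a \<noteq> orbit \<alpha> b"
      have "a \<in> {1..n}" "b \<in> {1..n}" using h by auto
      then have "separated (orbit \<alpha> a) (orbit \<alpha> b) \<or> separated (orbit \<alpha> b) (orbit \<alpha> a)"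
        using L ne by (auto simp: cycles_def)
      moreover have "a \<in> orbit \<alpha> a" "c \<in> orbit \<alpha> a" "b \<in> orbit \<alpha> b" "d \<in> orbit \<alpha> b"
        using h self by auto
      ultimately show False
        using h separated_iff_no_alternation[OF disj[OF ne]] by blast
    qed
  next
    assume N: "noncrossing_orbits n \<alpha>"
    show ?L
    proof (intro ballI impI)
      fix A B assume A: "A \<in> cycles n \<alpha>" and B: "B \<in> cycles n \<alpha>" and ne: "A \<noteq> B"
      have range: "x \<in> {1..n} \<and> orbit \<alpha> x = X" if "X \<in> cycles n \<alpha>" "x \<in> X" for x X
      proof -
        obtain y where y: "X = orbit \<alpha> y" "y \<in> {1..n}"
          using \<open>X \<in> cycles n \<alpha>\<close> unfolding cycles_def by blast
        then have "orbit \<alpha> y = orbit \<alpha> x" using that eq by blast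
        then show ?thesis using y that permutes_orbit_subset[OF assms y(2)] by blast
      qed
      have "A \<inter> B = {}" using A B ne disj by (auto simp: cycles_def)
      moreover have False
        if "a \<in> A" "b \<in> B" "a' \<in> A" "b' \<in> B" "a < b \<and> b < a' \<and> a' < b' \<or> b < a \<and> a < b' \<and> b' < a'"
        for a b a' b'
        using that range[OF A, of a] range[OF A, of a'] range[OF B, of b] range[OF B, of b'] ne
          noncrossing_orbitsD[OF N, of a b a' b'] noncrossing_orbitsD[OF N, of b a b' a'] by auto
      ultimately show "separated A B \<or> separated B A"
        unfolding separated_iff_no_alternation[OF \<open>A \<inter> B = {}\<close>] by blast
    qed
  }
qed

text \<open>
  The arrows leaving the vertices \<open>2, \<dots>, n\<close> are the pairs \<open>(i, \<alpha> i)\<close>, and the arrow leaving \<open>n + 1\<close>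
  always descends; so the chain condition is the claim for the cycle of 1, whose smallest
  element is 1. The smallest element of any other nontrivial cycle is followed by a larger one, so
  allowing at most one ascending arrow in a loop means forbidding all ascents elsewhere.
\<close>

lemma chain_loops_iff:
  assumes \<alpha>: "\<alpha> permutes {1..n}" and n: "n \<ge> 1"
  shows "(\<forall>(s, t)\<in>chain_arrows n \<alpha>. t < s) \<and> (\<forall>L\<in>loops n \<alpha>. card {(s, t)\<in>L. s < t} \<le> 1) \<longleftrightarrow>
    descending_cycles n \<alpha>" (is "?L \<longleftrightarrow> _")
proof
  have perm: "permutation \<alpha>" using \<alpha> by (auto simp: permutation_permutes)
  note eq = orbit_eq_iff[OF perm] and self = permutation_self_in_orbit[OF perm]
  have range: "\<alpha> x \<in> {1..n} \<longleftrightarrow> x \<in> {1..n}" for x using \<alpha> by (simp only: permutes_in_image)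
  have sub: "orbit \<alpha> x \<subseteq> {1..n}" if "x \<in> {1..n}" for x
    using permutes_orbit_subset[OF \<alpha> that] .
  let ?Q = "quiver n \<alpha>"
  have fin: "finite ?Q" unfolding quiver_def by simp
  {
    assume L: ?L
    show "descending_cycles n \<alpha>"
      unfolding descending_cycles_def
    proof (intro ballI impI)
      fix x y assume x: "x \<in> {1..n}" and y: "y \<in> orbit \<alpha> x" "y < x"
      have "y \<ge> 1" using sub[OF x] y by auto
      then have arrow: "(x, \<alpha> x) \<in> ?Q" using x y by (auto simp: quiver_def)
      show "\<alpha> x < x"
      proof (cases "x \<in> orbit \<alpha> 1")
        case True
        have "(n + 1, z) \<in> ?Q\<^sup>*" if "z \<in> orbit \<alpha> 1" for z
          using that
        proof induction
          case base
          then show ?case by (intro r_into_rtrancl) (simp add: quiver_def)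
        next
          case (step z)
          show ?case
          proof (cases "z = 1")
            case True
            then show ?thesis by (intro r_into_rtrancl) (simp add: quiver_def)
          next
            case False
            have "z \<in> {1..n}" using step.hyps sub[of 1] n by auto
            then have "(z, \<alpha> z) \<in> ?Q" using False by (auto simp: quiver_def)
            then show ?thesis using step.IH by (rule rtrancl_into_rtrancl[rotated])
          qed
        qed
        then have "(x, \<alpha> x) \<in> chain_arrows n \<alpha>"
          using True arrow by (simp add: chain_arrows_def)
        then show ?thesis using L by blast
      next
        case False
        have step: "(z, \<alpha> z) \<in> ?Q" if "z \<in> orbit \<alpha> x" for z
        proof -
          have "z \<in> {1..n}" using sub[OF x] that by blast
          moreover have "z \<noteq> 1" using that False eq by metis
          ultimately show ?thesis by (auto simp: quiver_def)
        qed
        have reach: "(x, z) \<in> ?Q\<^sup>+" if "z \<in> orbit \<alpha> x" for z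
          using that
        proof induction
          case base
          show ?case using arrow by (rule r_into_trancl)
        next
          case (step z)
          then show ?case using \<open>z \<in> orbit \<alpha> x \<Longrightarrow> (z, \<alpha> z) \<in> ?Q\<close> by (meson trancl_into_trancl)
        qed
        define l where "l = {a \<in> ?Q. (x, fst a) \<in> ?Q\<^sup>*}"
        have "l \<in> loops n \<alpha>"
          using reach[OF self] unfolding loops_def l_def by blast
        then have card: "card {(s, t)\<in>l. s < t} \<le> 1" using L by blast
        have in_l: "(z, \<alpha> z) \<in> l" if "z \<in> orbit \<alpha> x" for z
          using step[OF that] reach[OF that] by (simp add: l_def trancl_into_rtrancl)
        define m where "m = Min (orbit \<alpha> x)"
        have fin_orb: "finite (orbit \<alpha> x)" using finite_orbit[OF self] .
        have m: "m \<in> orbit \<alpha> x" "m \<le> y" "m \<le> \<alpha> m"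
          unfolding m_def using fin_orb self[of x] y
          by (auto intro!: Min_in Min_le orbit.step)
        have moved: "\<alpha> z \<noteq> z" if "z \<in> orbit \<alpha> x" for z
        proof
          assume "\<alpha> z = z"
          then have "orbit \<alpha> x = {z}"
            using that eq orbit_eq_singleton_iff by metis
          then show False using y self[of x] by auto
        qed
        show ?thesis
        proof (rule ccontr)
          assume "\<not> \<alpha> x < x"
          then have "{(m, \<alpha> m), (x, \<alpha> x)} \<subseteq> {(s, t)\<in>l. s < t}"
            using in_l m self[of x] moved[of x] moved[of m] by auto
          moreover have "finite {(s, t)\<in>l. s < t}"
            by (rule finite_subset[OF _ fin]) (auto simp: l_def)
          ultimately have "card {(m, \<alpha> m), (x, \<alpha> x)} \<le> 1" using card card_mono by (meson le_trans)
          then show False using m y by simp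
        qed
      qed
    qed
  next
    assume D: "descending_cycles n \<alpha>"
    have chain: "v = n + 1 \<or> v \<in> orbit \<alpha> 1" if "(n + 1, v) \<in> ?Q\<^sup>*" for v
      using that by induction (auto simp: quiver_def intro: orbit.intros)
    have "t < s" if "(s, t) \<in> chain_arrows n \<alpha>" for s t
    proof -
      have st: "(s, t) \<in> ?Q" and "(n + 1, s) \<in> ?Q\<^sup>*" using that by (auto simp: chain_arrows_def)
      then consider "s = n + 1" | "s \<in> orbit \<alpha> 1" "s \<noteq> n + 1" using chain by blast
      then show ?thesis
      proof cases
        case 1
        then have "t \<in> {1..n}" using st range[of s] range[of 1] n by (auto simp: quiver_def)
        then show ?thesis using 1 by simp
      next
        case 2
        then have s: "2 \<le> s" "s \<le> n" "t = \<alpha> s" using st by (auto simp: quiver_def)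
        then have "1 \<in> orbit \<alpha> s" using 2 eq by metis
        then show ?thesis using descending_cyclesD[OF D, of s 1] s by simp
      qed
    qed
    moreover have "card {(s, t)\<in>l. s < t} \<le> 1" if l_loop: "l \<in> loops n \<alpha>" for l
    proof -
      obtain v where l: "l = {a \<in> ?Q. (v, fst a) \<in> ?Q\<^sup>*}" and v: "(v, v) \<in> ?Q\<^sup>+"
        using l_loop unfolding loops_def by blast
      obtain w where "(w, v) \<in> ?Q" using v by (meson tranclE)
      then have v_le: "v \<in> {1..n}" using range[of w] range[of 1] n by (auto simp: quiver_def)
      have reach: "w \<in> orbit \<alpha> v" if "(v, w) \<in> ?Q\<^sup>*" for w
        using that
      proof induction
        case base
        show ?case by (rule self)
      next
        case (step w w')
        then have "w \<in> {1..n}" using sub[OF v_le] by blast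
        then have "w' = \<alpha> w" using step.hyps by (auto simp: quiver_def)
        then show ?case using step.IH by (auto intro: orbit.step)
      qed
      have asc: "s \<in> {1..n} \<and> s \<in> orbit \<alpha> v \<and> t = \<alpha> s \<and> (\<forall>y\<in>orbit \<alpha> v. s \<le> y)"
        if "(s, t) \<in> l" "s < t" for s t
      proof -
        have st: "s \<in> orbit \<alpha> v" "(s, t) \<in> ?Q" using that reach by (auto simp: l)
        then have s: "s \<in> {1..n}" using sub[OF v_le] by blast
        then have "t = \<alpha> s" using st by (auto simp: quiver_def)
        moreover have "orbit \<alpha> v = orbit \<alpha> s" using st eq by blast
        ultimately show ?thesis
          using descending_cyclesD[OF D, of s] s st that(2)
          by (metis atLeastAtMost_iff leI order_less_asym)
      qed
      have "a = b" if "a \<in> {(s, t)\<in>l. s < t}" "b \<in> {(s, t)\<in>l. s < t}" for a b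
      proof -
        have "fst a = fst b"
          using that asc[of "fst a" "snd a"] asc[of "fst b" "snd b"] by (auto intro!: antisym)
        then show ?thesis
          using that asc[of "fst a" "snd a"] asc[of "fst b" "snd b"] by (auto simp: prod_eq_iff)
      qed
      moreover have "finite {(s, t)\<in>l. s < t}"
        by (rule finite_subset[OF _ fin]) (auto simp: l)
      ultimately show ?thesis by (simp add: card_le_Suc0_iff_eq)
    qed
    ultimately show ?L by blast
  }
qed

lemma noncrossing_perm_iff:
  assumes "\<alpha> permutes {1..n}" "n \<ge> 1"
  shows "noncrossing_perm n \<alpha> \<longleftrightarrow> descending_cycles n \<alpha> \<and> noncrossing_orbits n \<alpha>"
  using chain_loops_iff[OF assms] separated_cycles_iff[OF assms(1)]
  unfolding noncrossing_perm_def by blast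

section \<open>The permutations \<open>[\<alpha>, 0]\<close>\<close>

lemma extend_zero_eq:
  assumes "\<alpha> permutes {1..n}" "n \<ge> 1"
  shows "extend_perm n \<alpha> 0 = transpose (\<alpha> 1) (n + 1) \<circ> \<alpha>"
proof -
  have "extend_perm n \<alpha> 0 = \<alpha> \<circ> transpose 1 (n + 1)"
    using extend_perm_eq(1)[OF assms, of 0] by simp
  moreover have "\<alpha> (n + 1) = n + 1" using assms by (simp add: permutes_not_in)
  then have "\<alpha> \<circ> transpose 1 (n + 1) = transpose (\<alpha> 1) (n + 1) \<circ> \<alpha>"
    using inj_eq[OF permutes_inj[OF assms(1)]] by (auto simp: transpose_def fun_eq_iff) metis
  ultimately show ?thesis by simp
qed

lemma extend_zero_value:
  assumes "\<alpha> permutes {1..n}" "n \<ge> 1"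
  shows "extend_perm n \<alpha> 0 1 = n + 1" "extend_perm n \<alpha> 0 (n + 1) = \<alpha> 1"
    "x \<noteq> 1 \<Longrightarrow> x \<noteq> n + 1 \<Longrightarrow> extend_perm n \<alpha> 0 x = \<alpha> x"
  using extend_perm_eq(1)[OF assms, of 0] assms by (auto simp: permutes_not_in)

text \<open>
  As a permutation of \<open>{1..n + 1}\<close>, \<open>\<alpha>\<close> has the fixed point \<open>n + 1\<close>; multiplying by
  the transposition merges it into the cycle of \<open>\<alpha> 1\<close>.
\<close>

lemma orbit_extend_zero:
  assumes \<alpha>: "\<alpha> permutes {1..n}" and n: "n \<ge> 1"
  shows "orbit (extend_perm n \<alpha> 0) x =
    (if x \<in> insert (n + 1) (orbit \<alpha> 1) then insert (n + 1) (orbit \<alpha> 1) else orbit \<alpha> x)"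
proof -
  have perm: "permutation \<alpha>" using \<alpha> by (auto simp: permutation_permutes)
  have "orbit \<alpha> (\<alpha> 1) = orbit \<alpha> 1" using perm by (rule permutation_orbit_step)
  moreover have "n + 1 \<notin> orbit \<alpha> 1" using permutes_orbit_subset[OF \<alpha>, of 1] n by auto
  moreover have "orbit \<alpha> (n + 1) = {n + 1}"
    using \<alpha> by (simp add: orbit_eq_singleton_iff permutes_not_in)
  ultimately show ?thesis
    unfolding extend_zero_eq[OF assms] using orbit_transpose_merge[OF perm, of "n + 1" "\<alpha> 1" x] by simp
qed

lemma in_orbit_extend_zero_iff:
  assumes \<alpha>: "\<alpha> permutes {1..n}" and n: "n \<ge> 1" and "x \<le> n" "y \<le> n"
  shows "y \<in> orbit (extend_perm n \<alpha> 0) x \<longleftrightarrow> y \<in> orbit \<alpha> x"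
proof -
  have perm: "permutation \<alpha>" using \<alpha> by (auto simp: permutation_permutes)
  show ?thesis
  proof (cases "x \<in> orbit \<alpha> 1")
    case True
    then have "orbit \<alpha> x = orbit \<alpha> 1" using orbit_eq_iff[OF perm] by blast
    then show ?thesis using True assms(3,4) orbit_extend_zero[OF \<alpha> n, of x] by simp
  next
    case False
    then show ?thesis using assms(3,4) orbit_extend_zero[OF \<alpha> n, of x] by simp
  qed
qed

lemma card_cycles_extend_zero:
  assumes \<alpha>: "\<alpha> permutes {1..n}" and n: "n \<ge> 1"
  shows "card (cycles (n + 1) (extend_perm n \<alpha> 0)) = card (cycles n \<alpha>)"
proof -
  have set: "{1..n + 1} = insert (n + 1) {1..n}" by auto
  have \<alpha>': "\<alpha> permutes {1..n + 1}" using \<alpha> by (rule permutes_subset) auto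
  have perm: "permutation \<alpha>" using \<alpha> by (auto simp: permutation_permutes)
  have new: "n + 1 \<notin> orbit \<alpha> x" if "x \<in> {1..n}" for x
    using permutes_orbit_subset[OF \<alpha> that] by auto
  have "orbit \<alpha> (n + 1) = {n + 1}"
    using \<alpha> by (simp add: orbit_eq_singleton_iff permutes_not_in)
  then have "orbit \<alpha> ` {1..n + 1} = insert {n + 1} (orbit \<alpha> ` {1..n})" unfolding set by simp
  moreover have "{n + 1} \<notin> orbit \<alpha> ` {1..n}" using new by blast
  ultimately have "card (orbit \<alpha> ` {1..n + 1}) = card (cycles n \<alpha>) + 1"
    by (simp add: cycles_def)
  moreover have "\<alpha> 1 \<in> {1..n}" using n by (simp only: permutes_in_image[OF \<alpha>]) simp
  then have "card (orbit (transpose (\<alpha> 1) (n + 1) \<circ> \<alpha>) ` {1..n + 1}) + 1 = card (orbit \<alpha> ` {1..n + 1})"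
    using new by (intro card_orbits_transpose_merge[OF \<alpha>']) auto
  ultimately show ?thesis unfolding extend_zero_eq[OF assms] by (simp add: cycles_def)
qed

lemma descending_cycles_extend_zero:
  assumes \<alpha>: "\<alpha> permutes {1..n}" and n: "n \<ge> 1"
  shows "descending_cycles (n + 1) (extend_perm n \<alpha> 0) \<longleftrightarrow> descending_cycles n \<alpha>"
    (is "descending_cycles _ ?\<gamma> \<longleftrightarrow> _")
proof -
  note orb = in_orbit_extend_zero_iff[OF assms]
  have "\<alpha> 1 \<in> {1..n}" using n by (simp only: permutes_in_image[OF \<alpha>]) simp
  then have top: "?\<gamma> (n + 1) < n + 1" using extend_zero_value[OF assms] by simp
  have rest: "(\<forall>y\<in>orbit ?\<gamma> x. y < x \<longrightarrow> ?\<gamma> x < x) \<longleftrightarrow> (\<forall>y\<in>orbit \<alpha> x. y < x \<longrightarrow> \<alpha> x < x)"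
    if "x \<in> {1..n}" for x
  proof (cases "x = 1")
    case True
    have "y \<ge> 1" if "y \<in> orbit \<alpha> 1" for y using permutes_orbit_subset[OF \<alpha>, of 1] n that by auto
    moreover have "y \<ge> 1" if "y \<in> orbit ?\<gamma> 1" for y
      using permutes_orbit_subset[OF extend_perm_eq(2)[OF assms], of 0 1] that by auto
    ultimately show ?thesis using True by (metis leD)
  next
    case False
    then have "?\<gamma> x = \<alpha> x" using extend_zero_value(3)[OF assms] that by simp
    moreover have "y \<in> orbit ?\<gamma> x \<longleftrightarrow> y \<in> orbit \<alpha> x" if "y < x" for y
      using orb \<open>x \<in> {1..n}\<close> that by simp
    ultimately show ?thesis by auto
  qed
  have set: "{1..n + 1} = insert (n + 1) {1..n}" by auto
  show ?thesis unfolding descending_cycles_def set using top rest by auto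
qed

text \<open>
  An alternating quadruple \<open>a, b, c, n + 1\<close> involves the cycle of 1, which contains \<open>b\<close>. Moving the
  last element to the front gives the alternating quadruple \<open>1, a, b, c\<close> of \<open>\<alpha>\<close>.
\<close>

lemma noncrossing_orbits_extend_zero:
  assumes \<alpha>: "\<alpha> permutes {1..n}" and n: "n \<ge> 1"
  shows "noncrossing_orbits (n + 1) (extend_perm n \<alpha> 0) \<longleftrightarrow> noncrossing_orbits n \<alpha>"
    (is "noncrossing_orbits _ ?\<gamma> \<longleftrightarrow> _")
proof
  have perm: "permutation \<alpha>" using \<alpha> by (auto simp: permutation_permutes)
  have perm': "permutation ?\<gamma>"
    using extend_perm_eq(2)[OF assms, of 0] by (auto simp: permutation_permutes)
  have orb: "orbit ?\<gamma> x = orbit ?\<gamma> y \<longleftrightarrow> orbit \<alpha> x = orbit \<alpha> y" if "x \<le> n" "y \<le> n" for x y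
    unfolding orbit_eq_iff[OF perm] orbit_eq_iff[OF perm'] by (rule in_orbit_extend_zero_iff[OF assms that])
  have top: "orbit ?\<gamma> (n + 1) = orbit ?\<gamma> 1"
    using orbit_extend_zero[OF assms] permutation_self_in_orbit[OF perm] by simp
  {
    assume "noncrossing_orbits (n + 1) ?\<gamma>"
    then show "noncrossing_orbits n \<alpha>"
      unfolding noncrossing_orbits_def using orb by (smt (verit) le_trans less_imp_le trans_le_add1)
  next
    assume N: "noncrossing_orbits n \<alpha>"
    show "noncrossing_orbits (n + 1) ?\<gamma>"
      unfolding noncrossing_orbits_def
    proof (intro allI impI)
      fix a b c d
      assume h: "1 \<le> a \<and> a < b \<and> b < c \<and> c < d \<and> d \<le> n + 1 \<and>
        orbit ?\<gamma> a = orbit ?\<gamma> c \<and> orbit ?\<gamma> b = orbit ?\<gamma> d"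
      then have ac: "orbit \<alpha> a = orbit \<alpha> c" using orb[of a c] by simp
      have "orbit \<alpha> a = orbit \<alpha> b"
      proof (cases "d = n + 1")
        case True
        then have b1: "orbit \<alpha> 1 = orbit \<alpha> b" using h top orb[of 1 b] n by simp
        show ?thesis
        proof (cases "a = 1")
          case True
          then show ?thesis using b1 by simp
        next
          case False
          then have "orbit \<alpha> 1 = orbit \<alpha> a"
            using h ac b1 by (intro noncrossing_orbitsD[OF N, of 1 a b c]) auto
          then show ?thesis using b1 by simp
        qed
      next
        case False
        then have "orbit \<alpha> b = orbit \<alpha> d" using h orb[of b d] by simp
        then show ?thesis using h False ac by (intro noncrossing_orbitsD[OF N, of a b c d]) auto
      qed
      then show "orbit ?\<gamma> a = orbit ?\<gamma> b" using orb[of a b] h by simp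
    qed
  }
qed

section \<open>Cutting the chain\<close>

text \<open>
  Here \<open>\<gamma>\<close> plays the role of \<open>[\<alpha>, 0]\<close>, \<open>\<beta>\<close> that of \<open>[\<alpha>, j]\<close>, and \<open>N\<close> is the letter that was added
  last. The cycle of 1 in \<open>\<gamma>\<close> contains \<open>N\<close>. If it also contains \<open>j\<close>, it is the union of the cycles
  of 1 and of \<open>N\<close> in \<open>\<beta>\<close>, called the low and the high piece below.
\<close>

locale chain_cut =
  fixes N j :: nat and \<gamma> \<beta> :: "nat \<Rightarrow> nat"
  assumes \<gamma>: "\<gamma> permutes {1..N}" and top: "\<gamma> 1 = N" and j: "1 \<le> j" "j < N"
    and \<beta>_def: "\<beta> = transpose j N \<circ> \<gamma>"
begin

lemma \<gamma>_perm: "permutation \<gamma>"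
  using \<gamma> by (auto simp: permutation_permutes)

lemma \<beta>: "\<beta> permutes {1..N}"
  unfolding \<beta>_def by (intro permutes_compose \<gamma> permutes_swap_id) (use j in auto)

lemma \<beta>_perm: "permutation \<beta>"
  using \<beta> by (auto simp: permutation_permutes)

lemma \<gamma>_eq: "\<gamma> = transpose j N \<circ> \<beta>"
  by (simp add: \<beta>_def fun_eq_iff)

lemmas \<gamma>_eq_iff = orbit_eq_iff[OF \<gamma>_perm] and \<beta>_eq_iff = orbit_eq_iff[OF \<beta>_perm]
  and \<gamma>_self = permutation_self_in_orbit[OF \<gamma>_perm]
  and \<beta>_self = permutation_self_in_orbit[OF \<beta>_perm]

lemma \<beta>_one: "\<beta> 1 = j"
  by (simp add: \<beta>_def top del: One_nat_def)

lemma orbit_\<gamma>_top: "orbit \<gamma> N = orbit \<gamma> 1"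
  using permutation_orbit_step[OF \<gamma>_perm, of 1] top by simp

lemma orbit_\<beta>_j: "orbit \<beta> j = orbit \<beta> 1"
  using permutation_orbit_step[OF \<beta>_perm, of 1] \<beta>_one by simp

lemma orbit_range: "x \<in> {1..N} \<Longrightarrow> orbit \<gamma> x \<subseteq> {1..N}" "x \<in> {1..N} \<Longrightarrow> orbit \<beta> x \<subseteq> {1..N}"
  by (rule permutes_orbit_subset[OF \<gamma>], assumption) (rule permutes_orbit_subset[OF \<beta>], assumption)

text \<open>
  The letter sent to \<open>N\<close> by \<open>\<beta>\<close> lies in the merged cycle. It is not 1, which is sent to \<open>j\<close>, so it is
  not the smallest element of its cycle and yet does not descend.
\<close>

lemma cut_off_chain:
  assumes "j \<notin> orbit \<gamma> 1"
  shows "\<not> descending_cycles N \<beta>" "card (cycles N \<beta>) + 1 = card (cycles N \<gamma>)"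
proof -
  have N: "N \<notin> orbit \<gamma> j" using assms \<gamma>_eq_iff orbit_\<gamma>_top by metis
  show "card (cycles N \<beta>) + 1 = card (cycles N \<gamma>)"
    unfolding cycles_def \<beta>_def using card_orbits_transpose_merge[OF \<gamma> _ _ _ N] j by auto
  show "\<not> descending_cycles N \<beta>"
  proof
    assume D: "descending_cycles N \<beta>"
    have "N \<in> orbit \<beta> 1"
      using orbit_transpose_merge[OF \<gamma>_perm N, of 1] \<gamma>_self[of 1] \<gamma>_self[of N] orbit_\<gamma>_top
      by (simp add: \<beta>_def)
    obtain y where y: "\<beta> y = N" using permutes_surj[OF \<beta>] by (metis surjD)
    then have "y \<in> orbit \<beta> 1" using \<open>N \<in> orbit \<beta> 1\<close> orbit_step_iff[OF \<beta>_perm] by metis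
    then have "y \<in> {1..N}" "1 \<in> orbit \<beta> y"
      using orbit_range(2)[of 1] j \<beta>_eq_iff[of 1 y] \<beta>_self[of 1] by auto
    moreover have "y \<noteq> 1" using y \<beta>_one j by auto
    ultimately show False using descending_cyclesD[OF D, of y 1] y by auto
  qed
qed

context
  assumes j_chain: "j \<in> orbit \<gamma> 1"
begin

lemma top_notin: "N \<notin> orbit \<beta> 1"
proof -
  have "N \<in> orbit \<gamma> j"
    using j_chain \<gamma>_eq_iff[of 1 j] \<gamma>_self[of N] orbit_\<gamma>_top by simp
  then have "N \<notin> orbit \<beta> j" unfolding \<beta>_def using j by (intro orbit_transpose_split) auto
  then show ?thesis by (simp add: orbit_\<beta>_j)
qed

lemma orbit_\<gamma>:
  "orbit \<gamma> x = (if x \<in> orbit \<beta> 1 \<union> orbit \<beta> N then orbit \<beta> 1 \<union> orbit \<beta> N else orbit \<beta> x)"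
  using orbit_transpose_merge[OF \<beta>_perm, of N j x] top_notin
  by (simp add: \<gamma>_eq[symmetric] orbit_\<beta>_j)

lemma card_split: "card (cycles N \<beta>) = card (cycles N \<gamma>) + 1"
  using card_orbits_transpose_merge[OF \<beta>, of j N] top_notin j
  by (simp add: cycles_def \<gamma>_eq[symmetric] orbit_\<beta>_j)

lemma orbit_\<gamma>_one: "orbit \<gamma> 1 = orbit \<beta> 1 \<union> orbit \<beta> N"
  using orbit_\<gamma>[of 1] \<beta>_self[of 1] by simp

lemma orbit_\<gamma>_other: "x \<notin> orbit \<gamma> 1 \<Longrightarrow> orbit \<gamma> x = orbit \<beta> x"
  using orbit_\<gamma>[of x] by (simp add: orbit_\<gamma>_one del: One_nat_def)

lemma orbit_\<beta>_mono:
  assumes "orbit \<beta> x = orbit \<beta> y"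
  shows "orbit \<gamma> x = orbit \<gamma> y"
proof -
  have "x \<in> orbit \<beta> w \<longleftrightarrow> y \<in> orbit \<beta> w" for w
    unfolding \<beta>_eq_iff[symmetric] using assms by simp
  then show ?thesis using assms orbit_\<gamma>[of x] orbit_\<gamma>[of y] by simp
qed

definition low_below_high :: bool where
  "low_below_high \<longleftrightarrow> (\<forall>x\<in>orbit \<beta> 1. \<forall>y\<in>orbit \<beta> N. x < y)"

text \<open>
  An element \<open>y\<close> of the high piece below an element \<open>x\<close> of the low piece would make
  \<open>1 < y < x < N\<close> a crossing.
\<close>

lemma low_below_highI:
  assumes "noncrossing_orbits N \<beta>"
  shows low_below_high
  unfolding low_below_high_def
proof (intro ballI)
  fix x y assume x: "x \<in> orbit \<beta> 1" and y: "y \<in> orbit \<beta> N"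
  have range: "x \<in> {1..N}" "y \<in> {1..N}" using x y orbit_range(2)[of 1] orbit_range(2)[of N] j by auto
  have orb: "orbit \<beta> 1 = orbit \<beta> x" "orbit \<beta> y = orbit \<beta> N" using x y \<beta>_eq_iff by blast+
  have ne: "orbit \<beta> 1 \<noteq> orbit \<beta> N" using top_notin \<beta>_eq_iff by blast
  show "x < y"
  proof (rule ccontr)
    assume "\<not> x < y"
    moreover have "x \<noteq> y" "x \<noteq> N" "y \<noteq> 1" using orb ne by metis+
    ultimately have "1 < y" "y < x" "x < N" using range by auto
    then show False using noncrossing_orbitsD[OF assms, of 1 y x N] orb ne by simp
  qed
qed

text \<open>
  A crossing of \<open>\<beta>\<close> would have to be between the two pieces, by the hypothesis on \<open>\<gamma>\<close>; but pieces of
  which one lies below the other cannot alternate.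
\<close>

lemma noncrossing_split:
  assumes N: "noncrossing_orbits N \<gamma>" and low: low_below_high
  shows "noncrossing_orbits N \<beta>"
  unfolding noncrossing_orbits_def
proof (intro allI impI)
  fix a b c d
  assume h: "1 \<le> a \<and> a < b \<and> b < c \<and> c < d \<and> d \<le> N \<and>
    orbit \<beta> a = orbit \<beta> c \<and> orbit \<beta> b = orbit \<beta> d"
  then have "orbit \<gamma> a = orbit \<gamma> c" "orbit \<gamma> b = orbit \<gamma> d" using orbit_\<beta>_mono by blast+
  then have ab: "orbit \<gamma> a = orbit \<gamma> b" using noncrossing_orbitsD[OF N, of a b c d] h by simp
  show "orbit \<beta> a = orbit \<beta> b"
  proof (cases "a \<in> orbit \<gamma> 1")
    case False
    then have "b \<notin> orbit \<gamma> 1" using ab \<gamma>_eq_iff by metis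
    then show ?thesis using False orbit_\<gamma>_other ab by metis
  next
    case True
    then have "b \<in> orbit \<gamma> 1" using ab \<gamma>_eq_iff by metis
    with True have "orbit \<beta> a \<in> {orbit \<beta> 1, orbit \<beta> N}" "orbit \<beta> b \<in> {orbit \<beta> 1, orbit \<beta> N}"
      using orbit_\<gamma>_one \<beta>_eq_iff by blast+
    moreover have mem: "a \<in> orbit \<beta> a" "b \<in> orbit \<beta> b" "c \<in> orbit \<beta> a" "d \<in> orbit \<beta> b"
      using h \<beta>_self by auto
    moreover have "u < v" if "u \<in> orbit \<beta> 1" "v \<in> orbit \<beta> N" for u v
      using low that by (auto simp: low_below_high_def)
    then have "\<not> (orbit \<beta> a = orbit \<beta> 1 \<and> orbit \<beta> b = orbit \<beta> N)"
      "\<not> (orbit \<beta> a = orbit \<beta> N \<and> orbit \<beta> b = orbit \<beta> 1)"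
      using h mem by (metis order_less_asym)+
    ultimately show ?thesis by auto
  qed
qed

text \<open>
  In a crossing of \<open>\<gamma>\<close> that is not already one of \<open>\<beta>\<close>, one of the two cycles is that of 1, and its two
  elements belong to different pieces, the smaller one to the low and the larger one to the high
  piece. Replacing one of them by an extreme element of \<open>{1..N}\<close> in its own piece gives a crossing
  of \<open>\<beta>\<close>: the larger one pairs with \<open>N\<close> if \<open>a, c\<close> are on the chain, and the smaller one pairs with 1
  if \<open>b, d\<close> are.
\<close>

lemma noncrossing_merge:
  assumes N: "noncrossing_orbits N \<beta>"
  shows "noncrossing_orbits N \<gamma>"
  unfolding noncrossing_orbits_def
proof (intro allI impI)
  fix a b c d
  assume h: "1 \<le> a \<and> a < b \<and> b < c \<and> c < d \<and> d \<le> N \<and>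
    orbit \<gamma> a = orbit \<gamma> c \<and> orbit \<gamma> b = orbit \<gamma> d"
  have ac: "a \<in> orbit \<gamma> 1 \<longleftrightarrow> c \<in> orbit \<gamma> 1" and bd: "b \<in> orbit \<gamma> 1 \<longleftrightarrow> d \<in> orbit \<gamma> 1"
    using h \<gamma>_eq_iff by metis+
  have low: "u < v" if "u \<in> orbit \<beta> 1" "v \<in> orbit \<beta> N" for u v
    using low_below_highI[OF N] that by (auto simp: low_below_high_def)
  have pieces: "u \<in> orbit \<beta> 1 \<and> v \<in> orbit \<beta> N"
    if "u \<in> orbit \<gamma> 1" "v \<in> orbit \<gamma> 1" "orbit \<beta> u \<noteq> orbit \<beta> v" "u < v" for u v
  proof -
    have "\<not> (u \<in> orbit \<beta> w \<and> v \<in> orbit \<beta> w)" for w using that(3) \<beta>_eq_iff by blast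
    moreover have "\<not> (v \<in> orbit \<beta> 1 \<and> u \<in> orbit \<beta> N)" using low[of v u] that(4) by auto
    ultimately show ?thesis using that(1,2) unfolding orbit_\<gamma>_one by blast
  qed
  have same: "orbit \<gamma> a = orbit \<gamma> b" if "orbit \<beta> a = orbit \<beta> c" "orbit \<beta> b = orbit \<beta> d"
    using that h by (intro orbit_\<beta>_mono noncrossing_orbitsD[OF N, of a b c d]) simp_all
  show "orbit \<gamma> a = orbit \<gamma> b"
  proof (cases "a \<in> orbit \<gamma> 1"; cases "b \<in> orbit \<gamma> 1")
    assume "a \<in> orbit \<gamma> 1" "b \<in> orbit \<gamma> 1"
    then have "orbit \<gamma> 1 = orbit \<gamma> a" "orbit \<gamma> 1 = orbit \<gamma> b" by (simp_all only: \<gamma>_eq_iff)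
    then show ?thesis by simp
  next
    assume "a \<notin> orbit \<gamma> 1" "b \<notin> orbit \<gamma> 1"
    then show ?thesis using h ac bd orbit_\<gamma>_other[of a] orbit_\<gamma>_other[of b]
        orbit_\<gamma>_other[of c] orbit_\<gamma>_other[of d] by (intro same) simp_all
  next
    assume a: "a \<in> orbit \<gamma> 1" and b: "b \<notin> orbit \<gamma> 1"
    then have bd': "orbit \<beta> b = orbit \<beta> d" using h bd orbit_\<gamma>_other[of b] orbit_\<gamma>_other[of d] by simp
    show ?thesis
    proof (rule ccontr)
      assume ne: "orbit \<gamma> a \<noteq> orbit \<gamma> b"
      then have "orbit \<beta> a \<noteq> orbit \<beta> c" using same bd' by blast
      then have "c \<in> orbit \<beta> N" using pieces[of a c] a ac h by simp
      then have cN: "orbit \<beta> c = orbit \<beta> N" using \<beta>_eq_iff[of N c] by simp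
      have "N \<in> orbit \<gamma> 1" using orbit_\<gamma>_top \<gamma>_self[of N] by simp
      then have "d < N" using b bd h by (metis le_neq_implies_less)
      then have "orbit \<beta> b = orbit \<beta> c"
        using noncrossing_orbitsD[OF N, of b c d N] h bd' cN by simp
      then show False using ne h orbit_\<beta>_mono by metis
    qed
  next
    assume a: "a \<notin> orbit \<gamma> 1" and b: "b \<in> orbit \<gamma> 1"
    then have ac': "orbit \<beta> a = orbit \<beta> c" using h ac orbit_\<gamma>_other[of a] orbit_\<gamma>_other[of c] by simp
    show ?thesis
    proof (rule ccontr)
      assume ne: "orbit \<gamma> a \<noteq> orbit \<gamma> b"
      then have "orbit \<beta> b \<noteq> orbit \<beta> d" using same ac' by blast
      then have "b \<in> orbit \<beta> 1" using pieces[of b d] b bd h by simp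
      then have b1: "orbit \<beta> 1 = orbit \<beta> b" by (simp only: \<beta>_eq_iff)
      have "1 < a" using a \<gamma>_self[of 1] h by (metis le_neq_implies_less)
      then have "orbit \<beta> 1 = orbit \<beta> a"
        using noncrossing_orbitsD[OF N, of 1 a b c] h ac' b1 by simp
      then show False using ne b1 orbit_\<beta>_mono by metis
    qed
  qed
qed

text \<open>
  Multiplication by the transposition changes only the images of 1 and of the letter that \<open>\<beta>\<close> sends
  to \<open>N\<close>. The latter is the smallest element of the high piece, since it does not descend; \<open>\<gamma>\<close> sends
  it to \<open>j\<close>, which is in the low piece and hence smaller.
\<close>

lemma descending_merge:
  assumes N: "noncrossing_orbits N \<beta>" and D: "descending_cycles N \<beta>"
  shows "descending_cycles N \<gamma>"
  unfolding descending_cycles_def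
proof (intro ballI impI)
  fix x y assume x: "x \<in> {1..N}" and y: "y \<in> orbit \<gamma> x" "y < x"
  have low: "u < v" if "u \<in> orbit \<beta> 1" "v \<in> orbit \<beta> N" for u v
    using low_below_highI[OF N] that by (auto simp: low_below_high_def)
  have j_low: "j \<in> orbit \<beta> 1" using orbit_\<beta>_j \<beta>_eq_iff by blast
  have "y \<ge> 1" using orbit_range(1)[OF x] y by auto
  have \<gamma>x: "\<gamma> x = transpose j N (\<beta> x)" by (simp add: \<gamma>_eq)
  consider "x \<in> orbit \<beta> 1" | "x \<in> orbit \<beta> N" | "x \<notin> orbit \<gamma> 1" using orbit_\<gamma>_one by blast
  then show "\<gamma> x < x"
  proof cases
    case 1
    then have "1 \<in> orbit \<beta> x" using \<beta>_eq_iff by metis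
    then have "\<beta> x < x" using descending_cyclesD[OF D, of x 1] x y \<open>y \<ge> 1\<close> by simp
    moreover have "\<beta> x \<noteq> j"
      using \<beta>_one y \<open>y \<ge> 1\<close> permutes_inj[OF \<beta>] by (metis inj_eq leD)
    ultimately show ?thesis using x \<gamma>x by (auto simp: transpose_def)
  next
    case 2
    have \<beta>x: "\<beta> x \<in> orbit \<beta> N" using 2 by (rule orbit.step)
    then have nj: "\<beta> x \<noteq> j" using low[OF j_low] by blast
    show ?thesis
    proof (cases "\<beta> x < x")
      case True
      then show ?thesis using \<gamma>x nj x by (auto simp: transpose_def)
    next
      case False
      obtain z where z: "\<beta> z = N" using permutes_surj[OF \<beta>] by (metis surjD)
      have zN: "z \<in> orbit \<beta> N" using z orbit_step_iff[OF \<beta>_perm, of z N] \<beta>_self[of N] by simp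
      then have zr: "z \<in> {1..N}" using orbit_range(2)[of N] j by auto
      have same: "orbit \<beta> z = orbit \<beta> N" "orbit \<beta> x = orbit \<beta> N" using zN 2 \<beta>_eq_iff by blast+
      have "\<not> x < z" using descending_cyclesD[OF D, of z x] z zr same \<beta>_self[of x] by auto
      moreover have "\<not> z < x" using descending_cyclesD[OF D, of x z] False x same \<beta>_self[of z] by auto
      ultimately have "\<gamma> x = j" using \<gamma>x z by simp
      then show ?thesis using low[OF j_low 2] by simp
    qed
  next
    case 3
    then have "orbit \<gamma> x = orbit \<beta> x" by (rule orbit_\<gamma>_other)
    moreover have "\<beta> x \<noteq> j" "\<beta> x \<noteq> N"
      using 3 orbit_\<gamma>_one orbit_step_iff[OF \<beta>_perm, of x] j_low \<beta>_self[of N] by auto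
    ultimately show ?thesis
      using descending_cyclesD[OF D, of x y] x y \<gamma>x by (simp add: transpose_def)
  qed
qed

text \<open>
  Let \<open>A\<close> be the part of the chain of \<open>\<gamma>\<close> up to \<open>j\<close>. As \<open>\<gamma>\<close> descends on the chain and
  \<open>\<beta> 1 = j\<close>, \<open>A\<close> is invariant under \<open>\<beta>\<close>, hence so is its complement: the low piece
  lies in \<open>A\<close> and the high piece above \<open>j\<close>. Apart from 1, only the letter \<open>x\<close> with
  \<open>\<gamma> x = j\<close> no longer descends, being sent to \<open>N\<close>; it has to be shown that no \<open>y\<close> in its cycle is
  smaller.
\<close>

lemma descending_split:
  assumes D: "descending_cycles N \<gamma>"
  shows low_below_high "descending_cycles N \<beta>"
proof -
  define A where "A = {x \<in> orbit \<gamma> 1. x \<le> j}"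
  have range: "x \<in> {1..N}" if "x \<in> orbit \<gamma> 1" for x using orbit_range(1)[of 1] that j by auto
  have desc: "\<gamma> x < x" if "x \<in> orbit \<gamma> 1" "x \<noteq> 1" for x
  proof -
    have "1 \<in> orbit \<gamma> x" using that \<gamma>_eq_iff by metis
    then show ?thesis using descending_cyclesD[OF D, of x 1] that range[of x] by auto
  qed
  have \<beta>x: "\<beta> x = transpose j N (\<gamma> x)" for x by (simp add: \<beta>_def)
  have A_closed: "\<beta> x \<in> A" if "x \<in> A" for x
  proof (cases "x = 1")
    case True
    then show ?thesis using \<beta>_one j_chain by (simp add: A_def)
  next
    case False
    have x: "x \<in> orbit \<gamma> 1" "x \<le> j" using that by (auto simp: A_def)
    then have "\<gamma> x < j" "\<gamma> x \<in> orbit \<gamma> 1" using desc[OF x(1) False] by (auto intro: orbit.step)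
    then show ?thesis using j by (simp add: \<beta>x A_def transpose_def)
  qed
  have low: "orbit \<beta> x \<subseteq> A" if "x \<in> A" for x
    using that A_closed by (rule orbit_subset_closed)
  have high: "orbit \<beta> x \<inter> A = {}" if "x \<notin> A" for x
    using orbit_disjoint_closed[OF \<beta>_perm A_closed that] .
  have "1 \<in> A" "N \<notin> A" using \<gamma>_self j by (auto simp: A_def)
  then have 1: "orbit \<beta> 1 \<subseteq> A" "orbit \<beta> N \<inter> A = {}" using low high by blast+
  have "orbit \<beta> N \<subseteq> orbit \<gamma> 1" using orbit_\<gamma>_one by blast
  then show low_below_high using 1 unfolding low_below_high_def A_def by fastforce
  show "descending_cycles N \<beta>"
    unfolding descending_cycles_def
  proof (intro ballI impI)
    fix x y assume x: "x \<in> {1..N}" and y: "y \<in> orbit \<beta> x" "y < x"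
    have "y \<ge> 1" using orbit_range(2)[OF x] y by auto
    then have "x \<noteq> 1" using y by simp
    have "orbit \<beta> y = orbit \<beta> x" using y \<beta>_eq_iff by blast
    then have "orbit \<gamma> y = orbit \<gamma> x" by (rule orbit_\<beta>_mono)
    then have y\<gamma>: "y \<in> orbit \<gamma> x" using \<gamma>_self[of y] by simp
    then have desc_x: "\<gamma> x < x" using descending_cyclesD[OF D, of x y] x y by simp
    show "\<beta> x < x"
    proof (cases "\<gamma> x = j")
      case False
      then show ?thesis using desc_x x by (simp add: \<beta>x transpose_def)
    next
      case True
      then have x1: "x \<in> orbit \<gamma> 1" using j_chain orbit_step_iff[OF \<gamma>_perm] by metis
      then have y1: "y \<in> orbit \<gamma> 1" using y\<gamma> \<gamma>_eq_iff by metis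
      have "x \<notin> A" using True desc_x by (simp add: A_def)
      then have "y \<notin> A" using high y by blast
      \<comment> \<open>The chain elements strictly between \<open>j\<close> and \<open>x\<close> would form a set invariant under \<open>\<gamma>\<close> that
        misses 1: such an element descends, but it cannot enter \<open>A\<close>, nor reach \<open>j\<close>, which comes from \<open>x\<close>.\<close>
      define G where "G = {z \<in> orbit \<gamma> 1. j < z \<and> z < x}"
      have G_closed: "\<gamma> z \<in> G" if "z \<in> G" for z
      proof -
        have z: "z \<in> orbit \<gamma> 1" "j < z" "z < x" using that by (auto simp: G_def)
        then have "\<gamma> z < z" using desc j by auto
        have "\<gamma> z \<noteq> j" using True z permutes_inj[OF \<gamma>] by (metis inj_eq less_irrefl)
        moreover have "\<gamma> z \<noteq> N" using \<open>\<gamma> z < z\<close> range[OF z(1)] by auto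
        ultimately have "\<beta> z = \<gamma> z" by (simp add: \<beta>x)
        moreover have "\<beta> z \<notin> A"
          using high[of z] z orbit.base[of \<beta> z] by (auto simp: A_def)
        ultimately show ?thesis
          using z \<open>\<gamma> z < z\<close> \<open>\<gamma> z \<noteq> j\<close> orbit.step[OF z(1)] by (auto simp: A_def G_def)
      qed
      have "y \<in> G" using y1 y \<open>y \<notin> A\<close> by (simp add: G_def A_def)
      then have "orbit \<gamma> y \<subseteq> G" using G_closed by (rule orbit_subset_closed)
      moreover have "1 \<in> orbit \<gamma> y" using y1 \<gamma>_eq_iff by metis
      ultimately show ?thesis using j by (auto simp: G_def)
    qed
  qed
qed

lemma noncrossing_cut_iff:
  "descending_cycles N \<beta> \<and> noncrossing_orbits N \<beta> \<longleftrightarrow>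
   descending_cycles N \<gamma> \<and> noncrossing_orbits N \<gamma>"
  using descending_merge descending_split noncrossing_merge noncrossing_split by blast

end

end

section \<open>The degree\<close>

definition FS_degree :: "nat \<Rightarrow> (nat \<Rightarrow> nat) \<Rightarrow> nat" where
  "FS_degree n \<alpha> = card (cycles n \<alpha>) + card (set_partition n \<alpha>)"

text \<open>For \<open>j \<noteq> 0\<close> blocks only grow, and they stay distinct since \<open>n + 1\<close> is a new letter.\<close>

lemma card_set_partition_extend:
  assumes \<alpha>: "\<alpha> permutes {1..n}" and n: "n \<ge> 1" and j: "j \<le> n"
  shows "card (set_partition (n + 1) (extend_perm n \<alpha> j)) =
    card (set_partition n \<alpha>) + (if j = 0 then 1 else 0)"
proof -
  let ?P = "set_partition n \<alpha>"
  have P: "partition_on {1..n} ?P" using \<alpha> by (rule partition_on_set_partition)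
  have fresh: "n + 1 \<notin> B" if "B \<in> ?P" for B
    using Union_upper[OF that] unfolding partition_onD1[OF P, symmetric] by auto
  have fin: "finite ?P" using finite_elements[OF _ P] by simp
  show ?thesis
  proof (cases "j = 0")
    case True
    have "{n + 1} \<notin> ?P" using fresh by blast
    then show ?thesis using True fin set_partition_extend(1)[OF \<alpha> n] by simp
  next
    case False
    have "inj_on (\<lambda>B. if j \<in> B then insert (n + 1) B else B) ?P"
      using fresh by (intro inj_onI) (metis insert_iff insert_ident)
    then have "card (set_partition (n + 1) (extend_perm n \<alpha> j)) = card ?P"
      using False j set_partition_extend(2)[OF \<alpha> n, of j] by (simp only: card_image less_one not_less)
    then show ?thesis using False by simp
  qed
qed

text \<open>
  The bound is needed for the induction: if \<open>j\<close> is off the chain the degree drops, and only the bound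
  for \<open>\<alpha>\<close> shows that it then misses the value required at the next step.
\<close>

lemma FS_degree_iff:
  assumes "\<alpha> permutes {1..n}" "n \<ge> 1"
  shows "FS_degree n \<alpha> \<le> n + 1 \<and>
    (FS_degree n \<alpha> = n + 1 \<longleftrightarrow> descending_cycles n \<alpha> \<and> noncrossing_orbits n \<alpha>)"
  using assms(2,1)
proof (induction n arbitrary: \<alpha> rule: dec_induct)
  case base
  then have "\<alpha> 1 = 1" using permutes_in_image[of \<alpha> "{1..1}" 1] by simp
  then have "orbit \<alpha> 1 = {1}" by (simp only: orbit_eq_singleton_iff)
  then show ?case
    by (auto simp: FS_degree_def cycles_def descending_cycles_def noncrossing_orbits_def)
next
  case (step n \<beta>)
  have n: "n \<ge> 1" using step.hyps by simp
  obtain \<alpha> j where \<alpha>: "\<alpha> permutes {1..n}" and j: "j \<le> n" and \<beta>: "\<beta> = extend_perm n \<alpha> j"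
    using extend_perm_surj[of \<beta> n] step.prems n by auto
  define \<gamma> where "\<gamma> = extend_perm n \<alpha> 0"
  have \<gamma>: "\<gamma> permutes {1..n + 1}" "\<gamma> 1 = n + 1"
    unfolding \<gamma>_def using extend_perm_eq(2)[OF \<alpha> n, of 0] extend_zero_value[OF \<alpha> n] by auto
  have NC_\<gamma>: "descending_cycles (n + 1) \<gamma> \<and> noncrossing_orbits (n + 1) \<gamma> \<longleftrightarrow>
      descending_cycles n \<alpha> \<and> noncrossing_orbits n \<alpha>"
    unfolding \<gamma>_def using descending_cycles_extend_zero[OF \<alpha> n] noncrossing_orbits_extend_zero[OF \<alpha> n]
    by simp
  have card_\<gamma>: "card (cycles (n + 1) \<gamma>) = card (cycles n \<alpha>)"
    unfolding \<gamma>_def by (rule card_cycles_extend_zero[OF \<alpha> n])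
  note IH = step.IH[OF \<alpha>]
  show ?case
  proof (cases "j = 0")
    case True
    then have "\<beta> = \<gamma>" using \<beta> \<gamma>_def by simp
    then have "FS_degree (n + 1) \<beta> = FS_degree n \<alpha> + 1"
      using card_set_partition_extend[OF \<alpha> n j] card_\<gamma> True \<beta> by (simp add: FS_degree_def)
    then show ?thesis using IH NC_\<gamma> \<open>\<beta> = \<gamma>\<close> by simp
  next
    case False
    have \<beta>\<gamma>: "\<beta> = transpose j (n + 1) \<circ> \<gamma>"
      unfolding \<beta> \<gamma>_def extend_perm_eq(1)[OF \<alpha> n j] using extend_perm_eq(1)[OF \<alpha> n, of 0] False
      by (simp add: comp_assoc)
    interpret cut: chain_cut "n + 1" j \<gamma> \<beta>
      by unfold_locales (use \<gamma> False j \<beta>\<gamma> in auto)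
    have part: "card (set_partition (n + 1) \<beta>) = card (set_partition n \<alpha>)"
      using card_set_partition_extend[OF \<alpha> n j] False \<beta> by simp
    show ?thesis
    proof (cases "j \<in> orbit \<gamma> 1")
      case True
      then have "FS_degree (n + 1) \<beta> = FS_degree n \<alpha> + 1"
        using cut.card_split part card_\<gamma> by (simp add: FS_degree_def)
      then show ?thesis using IH NC_\<gamma> cut.noncrossing_cut_iff[OF True] by simp
    next
      case False
      then have "FS_degree (n + 1) \<beta> + 1 = FS_degree n \<alpha>"
        using cut.cut_off_chain(2) part card_\<gamma> by (simp add: FS_degree_def)
      then show ?thesis using IH cut.cut_off_chain(1)[OF False] by simp
    qed
  qed
qed

theorem theorem5p4:
  fixes n :: nat and \<alpha> :: "nat \<Rightarrow> nat"
  assumes "n \<ge> 1" and "\<alpha> permutes {1..n}"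
  shows "ordinary_summation n \<alpha> \<longleftrightarrow> noncrossing_perm n \<alpha>"
proof -
  have "summation_degree (FS n \<alpha>) = FS_degree n \<alpha>"
    by (simp add: summation_degree_def FS_degree_def dP_FS dD_FS)
  then show ?thesis
    using FS_degree_iff[OF assms(2,1)] noncrossing_perm_iff[OF assms(2,1)]
    by (simp add: ordinary_summation_def)
qed

end
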